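(* Consider the multi-cell Massive MIMO system with correlated Rayleigh fading and MMSE channel estimation at the BSs described in the context, and suppose each BS uses maximum ratio (MR) precoding, $$\mathbf w_{lk}=\frac{\hat{\mathbf g}_{lk}^{l}}{\sqrt{\mathbb E\{\|\hat{\mathbf g}_{lk}^{l}\|^2\}}}\quad\text{for all } l,k.$$ Then the proposed estimator $$\hat\alpha_{lk}^{lk}=\begin{cases}\sqrt{(\xi_{lk}-T_{lk})/\eta_{lk}}, & \xi_{lk}>\Theta_{lk},\\ \mathbb E\{\alpha_{lk}^{lk}\}, & \text{otherwise,}\end{cases}$$ where $T_{lk}=\sum_{k'\ne k}\eta_{lk'}\mathbb E\{|\alpha_{lk}^{lk'}|^2\}+\sum_{l'\ne l}\sum_{k'=1}^K\eta_{l'k'}\mathbb E\{|\alpha_{lk}^{l'k'}|^2\}+\sigma_{\mathrm{DL}}^2$, can be computed with $$\begin{aligned}T_{lk}={}&\sum_{\substack{k'=1\\k'\neq k}}^{K}\rho_{\rm dl}\eta_{lk'}\frac{\mathrm{Tr}\bigl(\mathbf R_{lk'}^{l}\boldsymbol\Psi_{lk'}^{-1}\mathbf R_{lk'}^{l}\mathbf R_{lk}^{l}\bigr)}{\mathrm{Tr}\bigl(\mathbf R_{lk'}^{l}\boldsymbol\Psi_{lk'}^{-1}\mathbf R_{lk'}^{l}\bigr)}+\sum_{\substack{l'=1\\l'\neq l}}^{L}\sum_{k'=1}^{K}\rho_{\rm dl}\eta_{l'k'}\frac{\mathrm{Tr}\bigl(\mathbf R_{l'k'}^{l'}\boldsymbol\Psi_{l'k'}^{-1}\mathbf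 R_{l'k'}^{l'}\mathbf R_{lk}^{l'}\bigr)}{\mathrm{Tr}\bigl(\mathbf R_{l'k'}^{l'}\boldsymbol\Psi_{l'k'}^{-1}\mathbf R_{l'k'}^{l'}\bigr)}\\&+\sum_{l'\in\mathcal P_l\setminus\{l\}}\rho_{\rm dl}\eta_{l'k}\,\frac{\hat p_{lk}\tau_p\bigl|\mathrm{Tr}\bigl(\mathbf R_{lk}^{l'}\boldsymbol\Psi_{l'k}^{-1}\mathbf R_{l'k}^{l'}\bigr)\bigr|^2}{\mathrm{Tr}\bigl(\mathbf R_{l'k}^{l'}\boldsymbol\Psi_{l'k}^{-1}\mathbf R_{l'k}^{l'}\bigr)}+\sigma_{\mathrm{DL}}^2 .\end{aligned}$$
   Context: There are $L$ cells, each with an $M$-antenna BS and $K$ single-antenna users. The channel between BS $l$ and user $k'$ in cell $l'$ is $\mathbf g_{l'k'}^{l}\sim\mathcal{CN}(\mathbf 0,\mathbf R_{l'k'}^{l})$, where $\mathbf R_{l'k'}^{l}\in\mathbb C^{M\times M}$ is a known positive semi-definite matrix (with $\mathbf R_{lk}^l\ne\mathbf 0$); channels of different (BS, user) pairs are independent. Pilots: the cells are partitioned into groups; $\mathcal P_l$ is the group containing $l$ (cells using the same set of $K$ orthogonal pilots of length $\tau_p$). User $k$ of cell $l$ uses the same pilot as user $k$ of each cell in $\mathcal P_l$, and a pilot orthogonal to those of all other users. Pilot powers are $\hat p_{lk}>0$. After correlating with the pilot of user $k$ in cell $l$, BS $l$ has the observation $$\tilde{\mathbf y}_{lk}=\sum_{l'\in\mathcal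 P_l}\tau_p\sqrt{\hat p_{l'k}}\,\mathbf g_{l'k}^{l}+\tilde{\mathbf n}_{lk},\qquad \tilde{\mathbf n}_{lk}\sim\mathcal{CN}(\mathbf 0,\tau_p\sigma_{\mathrm{UL}}^2\mathbf I_M),$$ with $\sigma_{\mathrm{UL}}^2>0$ and noises independent of all channels and of each other. The MMSE estimate is $\hat{\mathbf g}_{lk}^{l}=\sqrt{\hat p_{lk}}\,\mathbf R_{lk}^{l}\boldsymbol\Psi_{lk}^{-1}\tilde{\mathbf y}_{lk}$ with $\boldsymbol\Psi_{lk}=\sum_{l'\in\mathcal P_l}\tau_p\hat p_{l'k}\mathbf R_{l'k}^{l}+\sigma_{\mathrm{UL}}^2\mathbf I_M$. Downlink: $\mathbf w_{lk}\in\mathbb C^M$ is the precoding vector of BS $l$ for its user $k$; $\alpha_{lk}^{l'k'}=\sqrt{\rho_{\rm dl}}\,(\mathbf g_{lk}^{l'})^{\rm H}\mathbf w_{l'k'}$ is the effective channel gain; $\rho_{\rm dl}>0$ is the maximum downlink power; $\eta_{lk}\in[0,1]$ are fixed power coefficients; $\sigma_{\mathrm{DL}}^2$ is the downlink noise variance. Expectations are over the channel realizations and pilot noise. $\xi_{lk}$ is the sample average $\frac{1}{\tau_c-\tau_p}\sum_{n}|y_{lk}[n]|^2$ of the power of the signals $y_{lk}[n]$ received by user $k$ in cell $l$ during the data part of a coherence interval of $\tau_c$ symbols, and $\Theta_{lk}\geq T_{lk}$ is a chosen threshold. *)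

theory Defs
  imports "HOL-Analysis.Analysis" "HOL-Probability.Independent_Family"
begin

definition hermitian_transpose :: "complex^'n^'m \<Rightarrow> complex^'m^'n" where
  "hermitian_transpose A = (\<chi> i j. cnj (A $ j $ i))"

text \<open>\<open>herm_prod x y\<close> is \<open>x\<^sup>H y\<close>, conjugate-linear in the first argument (the inner product
  \<open>x \<bullet> y\<close> of the library on \<^typ>\<open>complex^'n\<close> is only its real part).\<close>

definition herm_prod :: "complex^'n \<Rightarrow> complex^'n \<Rightarrow> complex" where
  "herm_prod x y = (\<Sum>i\<in>UNIV. cnj (x $ i) * y $ i)"

definition positive_semidefinite :: "complex^'n^'n \<Rightarrow> bool" where
  "positive_semidefinite A \<longleftrightarrow>
     hermitian_transpose A = A \<and> (\<forall>x. 0 \<le> Re (herm_prod x (A *v x)))"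

text \<open>The law \<open>CN(0, I)\<close>: independent entries, whose real and imaginary parts are independent
  centred normal variables of variance 1/2. Its density with respect to Lebesgue measure on
  \<^typ>\<open>complex^'n\<close> (real dimension \<open>2n\<close>) is \<open>exp (- |z|\<^sup>2) / pi^n\<close>.\<close>

definition std_complex_normal :: "(complex^'n) measure" where
  "std_complex_normal =
     density lborel (\<lambda>z. ennreal (exp (- (norm z)\<^sup>2) / pi ^ CARD('n)))"

text \<open>The circularly symmetric law \<open>CN(0, R)\<close> is the law of \<open>A z\<close> with \<open>z\<close> of law \<open>CN(0, I)\<close> and
  \<open>A A\<^sup>H = R\<close>; it does not depend on the factor \<open>A\<close>. A density is not available here, because \<open>R\<close>
  may be singular.\<close>

definition complex_normal_rv ::
    "'w measure \<Rightarrow> ('w \<Rightarrow> complex^'n) \<Rightarrow> complex^'n^'n \<Rightarrow> bool" where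
  "complex_normal_rv \<Omega> X R \<longleftrightarrow>
     X \<in> borel_measurable \<Omega> \<and>
     (\<exists>A :: complex^'n^'n. A ** hermitian_transpose A = R \<and>
        distr \<Omega> borel X = distr std_complex_normal borel (\<lambda>z. A *v z))"

end

theory Submission
  imports Defs "HOL-Probability.Distributions"
begin

text \<open>
  Fix BS \<open>l'\<close> and its user \<open>k'\<close>, and put \<open>B = R \<Psi>\<^sup>-\<^sup>1\<close> with \<open>R\<close> the covariance of the user's own channel.
  Up to normalisation the gain towards user \<open>k\<close> of cell \<open>l\<close> is \<open>a\<^sup>H B (c a + r)\<close>, where \<open>a\<close> is the
  interfering channel, of covariance \<open>R\<^sub>a\<close>, \<open>r\<close> collects the part of the pilot observation independent
  of \<open>a\<close>, and \<open>c = 0\<close> unless the two users share a pilot. The cross term vanishes because \<open>r\<close> is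
  centred. The pairing formula for fourth moments of a complex normal vector gives
  \<open>E |a\<^sup>H B a|\<^sup>2 = |Tr (B R\<^sub>a)|\<^sup>2 + Tr (B R\<^sub>a B\<^sup>H R\<^sub>a)\<close>, so that
  \<open>E |a\<^sup>H B (c a + r)|\<^sup>2 = c\<^sup>2 |Tr (B R\<^sub>a)|\<^sup>2 + Tr (B W B\<^sup>H R\<^sub>a)\<close> with
  \<open>W = \<tau>\<^sub>p \<Psi>\<close> the covariance of the whole observation, and \<open>B W B\<^sup>H = \<tau>\<^sub>p R \<Psi>\<^sup>-\<^sup>1 R\<close>.
\<close>

subsection \<open>Moments of the standard complex normal law\<close>

lemma borel_measurable_vec_nth [measurable (raw)]:
  fixes f :: "'a \<Rightarrow> 'b::real_normed_vector^'n"
  assumes "f \<in> borel_measurable M"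
  shows "(\<lambda>x. f x $ i) \<in> borel_measurable M"
  using assms by (rule borel_measurable_continuous_on[rotated]) (intro continuous_intros)

lemma borel_measurable_cnj [measurable (raw)]:
  assumes "f \<in> borel_measurable M"
  shows "(\<lambda>x. cnj (f x)) \<in> borel_measurable M"
  using assms by (rule borel_measurable_continuous_on[rotated]) (intro continuous_intros)

lemma borel_measurable_vec_lambda:
  fixes f :: "'a \<Rightarrow> 'n::finite \<Rightarrow> 'b::euclidean_space"
  assumes [measurable]: "\<And>i. (\<lambda>x. f x i) \<in> borel_measurable M"
  shows "(\<lambda>x. \<chi> i. f x i) \<in> borel_measurable M"
proof (rule borel_measurable_euclidean_space[THEN iffD2], rule ballI)
  fix b :: "'b^'n" assume "b \<in> Basis"
  then obtain i u where "b = axis i u" by (auto simp: Basis_vec_def)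
  then have "(\<lambda>x. (\<chi> i. f x i) \<bullet> b) = (\<lambda>x. f x i \<bullet> u)" by (simp add: inner_axis)
  then show "(\<lambda>x. (\<chi> i. f x i) \<bullet> b) \<in> borel_measurable M" by simp
qed

lemma lborel_eq_distr_PiM_vec:
  "(lborel :: ('a::euclidean_space^'n) measure) =
     distr (PiM UNIV (\<lambda>_. lborel)) borel (\<lambda>f. \<chi> i. f i)"
proof (rule lborel_eqI)
  let ?F = "\<lambda>f::'n \<Rightarrow> 'a. \<chi> i. f i"
  interpret product_sigma_finite "\<lambda>_::'n. lborel :: 'a measure" ..
  have F[measurable]: "?F \<in> PiM UNIV (\<lambda>_. lborel) \<rightarrow>\<^sub>M borel"
    by (rule borel_measurable_vec_lambda) simp
  fix l u :: "'a^'n"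
  assume le: "\<And>b. b \<in> Basis \<Longrightarrow> l \<bullet> b \<le> u \<bullet> b"
  have le': "l $ i \<bullet> b \<le> u $ i \<bullet> b" if "b \<in> Basis" for i b
    using le[of "axis i b"] that by (auto simp: Basis_vec_def inner_axis)
  have box: "?F -` box l u \<inter> space (PiM UNIV (\<lambda>_. lborel)) = (\<Pi>\<^sub>E i\<in>UNIV. box (l $ i) (u $ i))"
    by (auto simp: space_PiM mem_box Basis_vec_def inner_axis PiE_iff)
  have inj: "inj_on (\<lambda>(i::'n, b::'a). axis i b) (UNIV \<times> Basis)"
    by (auto simp: inj_on_def axis_eq_axis)
  have "emeasure (distr (PiM UNIV (\<lambda>_. lborel)) borel ?F) (box l u)
      = (\<Prod>i\<in>UNIV. emeasure lborel (box (l $ i) (u $ i)))"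
    by (simp add: emeasure_distr box emeasure_PiM)
  also have "\<dots> = (\<Prod>i\<in>UNIV. ennreal (\<Prod>b\<in>Basis. (u $ i - l $ i) \<bullet> b))"
    using le' by simp
  also have "\<dots> = ennreal (\<Prod>i\<in>UNIV. \<Prod>b\<in>Basis. (u $ i - l $ i) \<bullet> b)"
    by (rule prod_ennreal) (use le' in \<open>auto intro!: prod_nonneg simp: inner_diff_left\<close>)
  also have "(\<Prod>i\<in>UNIV. \<Prod>b\<in>Basis. (u $ i - l $ i) \<bullet> b)
      = (\<Prod>(i, b)\<in>UNIV \<times> Basis. (u - l) \<bullet> axis i b)"
    by (simp add: prod.cartesian_product inner_axis)
  also have "\<dots> = (\<Prod>b\<in>(\<lambda>(i, b). axis i b) ` (UNIV \<times> Basis). (u - l) \<bullet> b)"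
    by (subst prod.reindex[OF inj]) (simp add: split_def o_def)
  also have "(\<lambda>(i::'n, b::'a). axis i b) ` (UNIV \<times> Basis) = Basis"
    by (auto simp: Basis_vec_def)
  finally show "emeasure (distr (PiM UNIV (\<lambda>_. lborel)) borel ?F) (box l u)
      = ennreal (\<Prod>b\<in>Basis. (u - l) \<bullet> b)" .
qed simp

lemma lborel_complex_eq_distr:
  "(lborel :: complex measure) = distr (lborel \<Otimes>\<^sub>M lborel) borel (\<lambda>(x, y). Complex x y)"
proof (rule lborel_eqI)
  have F[measurable]: "(\<lambda>(x, y). Complex x y) \<in> lborel \<Otimes>\<^sub>M lborel \<rightarrow>\<^sub>M borel"
    by (simp add: split_def Complex_eq)
  fix l u :: complex
  assume le: "\<And>b. b \<in> Basis \<Longrightarrow> l \<bullet> b \<le> u \<bullet> b"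
  have le': "Re l \<le> Re u" "Im l \<le> Im u"
    using le[of 1] le[of \<i>] by (auto simp: Basis_complex_def)
  have "(\<lambda>(x, y). Complex x y) -` box l u \<inter> space (lborel \<Otimes>\<^sub>M lborel)
      = box (Re l) (Re u) \<times> box (Im l) (Im u)"
    by (auto simp: space_pair_measure mem_box Basis_complex_def)
  then have "emeasure (distr (lborel \<Otimes>\<^sub>M lborel) borel (\<lambda>(x, y). Complex x y)) (box l u)
      = emeasure lborel (box (Re l) (Re u)) * emeasure lborel (box (Im l) (Im u))"
    by (simp add: emeasure_distr lborel.emeasure_pair_measure_Times)
  also have "\<dots> = ennreal ((Re u - Re l) * (Im u - Im l))"
    using le' by (simp add: ennreal_mult)
  finally show "emeasure (distr (lborel \<Otimes>\<^sub>M lborel) borel (\<lambda>(x, y). Complex x y)) (box l u)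
      = ennreal (\<Prod>b\<in>Basis. (u - l) \<bullet> b)"
    by (simp add: Basis_complex_def)
qed simp

definition gauss_weight :: "complex \<Rightarrow> complex" where
  "gauss_weight z = complex_of_real (exp (- (cmod z)\<^sup>2) / pi)"

text \<open>\<open>gauss_moment p q\<close> is \<open>E (z\<^sup>p (cnj z)\<^sup>q)\<close> for \<open>z\<close> of law \<open>CN(0, 1)\<close>.\<close>

definition gauss_moment :: "nat \<Rightarrow> nat \<Rightarrow> complex" where
  "gauss_moment p q = (if p = q then fact p else 0)"

abbreviation half_normal :: "real \<Rightarrow> real" where
  "half_normal \<equiv> normal_density 0 (1 / sqrt 2)"

lemma half_normal_eq: "half_normal x = exp (- x\<^sup>2) / sqrt pi"
  by (simp add: normal_density_def power_divide)

lemma has_bochner_integral_half_normal: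
  "has_bochner_integral lborel (\<lambda>x. half_normal x) 1"
  "has_bochner_integral lborel (\<lambda>x. half_normal x * x) 0"
  "has_bochner_integral lborel (\<lambda>x. half_normal x * x^2) (1/2)"
  "has_bochner_integral lborel (\<lambda>x. half_normal x * x^3) 0"
  "has_bochner_integral lborel (\<lambda>x. half_normal x * x^4) (3/4)"
  using normal_moment_even[of "1 / sqrt 2" 0 0] normal_moment_odd[of "1 / sqrt 2" 0 0]
    normal_moment_even[of "1 / sqrt 2" 0 1] normal_moment_odd[of "1 / sqrt 2" 0 1]
    normal_moment_even[of "1 / sqrt 2" 0 2]
  by (simp_all add: power_divide fact_numeral numeral_eq_Suc)

lemma has_bochner_integral_complex_gauss:
  assumes "has_bochner_integral lborel (\<lambda>x. half_normal x * f x) a"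
    and "has_bochner_integral lborel (\<lambda>x. half_normal x * g x) b"
    and [measurable]: "f \<in> borel_measurable borel" "g \<in> borel_measurable borel"
  shows "has_bochner_integral lborel (\<lambda>z. complex_of_real (f (Re z) * g (Im z)) * gauss_weight z)
           (complex_of_real (a * b))"
proof -
  interpret lborel_pair: pair_sigma_finite "lborel :: real measure" "lborel :: real measure" ..
  let ?h = "\<lambda>(x, y). (half_normal x * f x) * (half_normal y * g y)"
  have M[measurable]: "(\<lambda>(x, y). Complex x y) \<in> lborel \<Otimes>\<^sub>M lborel \<rightarrow>\<^sub>M borel"
    by (simp add: split_def Complex_eq)
  have "integrable lborel (\<lambda>x. half_normal x * \<bar>f x\<bar>)"
    using assms(1) integrable_abs[of lborel "\<lambda>x. half_normal x * f x"]
    by (simp add: has_bochner_integral_iff abs_mult)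
  then have I1: "integrable (lborel \<Otimes>\<^sub>M lborel) ?h"
    using assms(1,2) by (intro lborel_pair.Fubini_integrable) (auto simp: has_bochner_integral_iff abs_mult)
  have I2: "(\<integral>x. ?h x \<partial>(lborel \<Otimes>\<^sub>M lborel)) = a * b"
    using assms(1,2) I1 lborel_pair.integral_fst'[OF I1] by (simp add: has_bochner_integral_iff)
  have "has_bochner_integral (lborel \<Otimes>\<^sub>M lborel) (\<lambda>x. complex_of_real (?h x)) (complex_of_real (a * b))"
    using I1 I2 by (simp add: has_bochner_integral_iff)
  moreover have "complex_of_real (?h x) =
     (\<lambda>z. complex_of_real (f (Re z) * g (Im z)) * gauss_weight z) (case x of (x, y) \<Rightarrow> Complex x y)" for x
    by (cases x) (simp add: half_normal_eq gauss_weight_def cmod_def exp_add[symmetric] field_simps exp_diff exp_minus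
       flip: of_real_mult of_real_divide)
  ultimately have "has_bochner_integral (lborel \<Otimes>\<^sub>M lborel)
    (\<lambda>x. (\<lambda>z. complex_of_real (f (Re z) * g (Im z)) * gauss_weight z) (case x of (x, y) \<Rightarrow> Complex x y)) (complex_of_real (a * b))"
    by (simp only:)
  then show ?thesis
    unfolding gauss_weight_def
    by (subst lborel_complex_eq_distr, intro has_bochner_integral_distr) auto
qed


text \<open>The values are moments of a real normal variable of variance 1/2, and only for orders up to 4.\<close>

definition half_moment :: "nat \<Rightarrow> real" where
  "half_moment n = (if n = 0 then 1 else if n = 2 then 1/2 else if n = 4 then 3/4 else 0)"

lemma has_bochner_integral_half_moment:
  assumes "n \<le> 4"
  shows "has_bochner_integral lborel (\<lambda>x. half_normal x * x ^ n) (half_moment n)"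
proof -
  have "n = 0 \<or> n = 1 \<or> n = 2 \<or> n = 3 \<or> n = 4" using assms by linarith
  then show ?thesis
    using has_bochner_integral_half_normal by (auto simp: half_moment_def)
qed

lemma has_bochner_integral_gauss_moment:
  assumes "p \<le> 2" "q \<le> 2"
  shows "has_bochner_integral lborel (\<lambda>z. z ^ p * cnj z ^ q * gauss_weight z) (gauss_moment p q)"
proof -
  let ?c = "\<lambda>s t. of_nat (p choose s) * of_nat (q choose t) * \<i> ^ (p - s) * (- \<i>) ^ (q - t) :: complex"
  have 1: "has_bochner_integral lborel
      (\<lambda>z. \<Sum>s\<le>p. \<Sum>t\<le>q. ?c s t * (complex_of_real (Re z ^ (s + t) * Im z ^ (p - s + (q - t))) * gauss_weight z))
      (\<Sum>s\<le>p. \<Sum>t\<le>q. ?c s t * complex_of_real (half_moment (s + t) * half_moment (p - s + (q - t))))"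
    using assms
    by (intro has_bochner_integral_sum has_bochner_integral_mult_right
          has_bochner_integral_complex_gauss has_bochner_integral_half_moment) auto
  have 2: "(\<Sum>s\<le>p. \<Sum>t\<le>q. ?c s t * (complex_of_real (Re z ^ (s + t) * Im z ^ (p - s + (q - t))) * gauss_weight z))
      = z ^ p * cnj z ^ q * gauss_weight z" for z
  proof -
    have zp: "z ^ p = (\<Sum>s\<le>p. of_nat (p choose s) * complex_of_real (Re z) ^ s * (\<i> * complex_of_real (Im z)) ^ (p - s))"
      by (subst complex_eq) (rule binomial_ring)
    have cz: "cnj z = complex_of_real (Re z) + - \<i> * complex_of_real (Im z)"
      by (simp add: complex_eq_iff)
    have zq: "cnj z ^ q = (\<Sum>t\<le>q. of_nat (q choose t) * complex_of_real (Re z) ^ t * (- \<i> * complex_of_real (Im z)) ^ (q - t))"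
      by (subst cz) (rule binomial_ring)
    show ?thesis
      unfolding zp zq unfolding sum_product unfolding sum_distrib_right
      by (intro sum.cong refl) (simp only: power_add power_mult_distrib of_real_mult of_real_power mult_ac)
  qed
  have "p = 0 \<or> p = 1 \<or> p = 2" "q = 0 \<or> q = 1 \<or> q = 2" using assms by linarith+
  then have 3: "(\<Sum>s\<le>p. \<Sum>t\<le>q. ?c s t * complex_of_real (half_moment (s + t) * half_moment (p - s + (q - t))))
      = gauss_moment p q"
    by (elim disjE) (simp_all add: half_moment_def gauss_moment_def numeral_2_eq_2 complex_eq_iff)
  show ?thesis using 1 unfolding 2 3 .
qed

lemma has_bochner_integral_std_complex_normal_prod:
  fixes p q :: "'n::finite \<Rightarrow> nat"
  assumes "\<And>m. p m \<le> 2" "\<And>m. q m \<le> 2"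
  shows "has_bochner_integral (std_complex_normal :: (complex^'n) measure)
     (\<lambda>z. \<Prod>m\<in>UNIV. (z $ m) ^ p m * cnj (z $ m) ^ q m) (\<Prod>m\<in>UNIV. gauss_moment (p m) (q m))"
proof -
  let ?f = "\<lambda>m z. z ^ p m * cnj z ^ q m * gauss_weight z"
  interpret product_sigma_finite "\<lambda>_::'n. lborel :: complex measure" ..
  have f: "integrable lborel (?f m)" "integral\<^sup>L lborel (?f m) = gauss_moment (p m) (q m)" for m
    using has_bochner_integral_gauss_moment[OF assms, of m m] by (auto simp: has_bochner_integral_iff)
  have "has_bochner_integral (PiM UNIV (\<lambda>_. lborel)) (\<lambda>z. \<Prod>m\<in>UNIV. ?f m (z m))
      (\<Prod>m\<in>UNIV. gauss_moment (p m) (q m))"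
    using product_integrable_prod[of UNIV ?f] product_integral_prod[of UNIV ?f] f
    by (simp add: has_bochner_integral_iff)
  then have "has_bochner_integral (PiM UNIV (\<lambda>_. lborel))
     (\<lambda>z. (\<lambda>z::complex^'n. \<Prod>m\<in>UNIV. ?f m (z $ m)) (\<chi> i. z i))
      (\<Prod>m\<in>UNIV. gauss_moment (p m) (q m))"
    by simp
  then have "has_bochner_integral lborel (\<lambda>z::complex^'n. \<Prod>m\<in>UNIV. ?f m (z $ m))
      (\<Prod>m\<in>UNIV. gauss_moment (p m) (q m))"
    unfolding gauss_weight_def by (subst lborel_eq_distr_PiM_vec, intro has_bochner_integral_distr)
      (auto intro!: borel_measurable_vec_lambda)
  moreover have "(\<Prod>m\<in>UNIV. gauss_weight (z $ m)) = complex_of_real (exp (- (norm z)\<^sup>2) / pi ^ CARD('n))"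
    for z :: "complex^'n"
    by (simp add: gauss_weight_def norm_vec_def L2_set_def sum_nonneg prod_dividef
         flip: of_real_prod exp_sum sum_negf)
  ultimately show ?thesis unfolding std_complex_normal_def
    by (intro has_bochner_integral_density) (auto simp: prod.distrib scaleR_conv_of_real mult_ac)
qed

lemma prod_power_indicator:
  fixes f :: "'n::finite \<Rightarrow> 'a::comm_monoid_mult"
  shows "(\<Prod>m\<in>UNIV. f m ^ (if m = i then 1 else 0)) = f i"
proof -
  have "(\<Prod>m\<in>UNIV. f m ^ (if m = i then 1 else 0)) = (\<Prod>m\<in>UNIV. if m = i then f m else 1)"
    by (intro prod.cong) auto
  then show ?thesis by simp
qed

lemma prod_gauss_moment:
  fixes p q :: "'n::finite \<Rightarrow> nat"
  shows "(\<Prod>m\<in>UNIV. gauss_moment (p m) (q m)) = (if p = q then \<Prod>m\<in>UNIV. fact (p m) else 0)"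
  by (auto simp: gauss_moment_def fun_eq_iff)

lemma std_complex_normal_moments:
  fixes i j k l :: "'n::finite"
  shows "has_bochner_integral std_complex_normal (\<lambda>z. z $ i) 0"
    and "has_bochner_integral std_complex_normal (\<lambda>z. z $ i * cnj (z $ j)) (if i = j then 1 else 0)"
    and "has_bochner_integral std_complex_normal (\<lambda>z. z $ i * cnj (z $ j) * z $ k * cnj (z $ l))
      ((if i = j then 1 else 0) * (if k = l then 1 else 0) + (if i = l then 1 else 0) * (if k = j then 1 else 0))"
proof -
  define e :: "'n \<Rightarrow> 'n \<Rightarrow> nat" where "e = (\<lambda>i m. if m = i then 1 else 0)"
  have e: "(\<Prod>m\<in>UNIV. f m ^ e i m) = f i" for f :: "'n \<Rightarrow> complex" and i
    unfolding e_def by (rule prod_power_indicator)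
  have e_eq: "e i = e j \<longleftrightarrow> i = j" for i j
    by (auto simp: e_def fun_eq_iff split: if_splits)
  have e_le: "e i m \<le> 2" for i m
    by (simp add: e_def)
  have fact_e: "fact (e i m) = (1::complex)" for i m
    by (simp add: e_def)
  have "e i \<noteq> (\<lambda>_. 0)" by (auto simp: e_def fun_eq_iff)
  then show "has_bochner_integral std_complex_normal (\<lambda>z. z $ i) 0"
    using has_bochner_integral_std_complex_normal_prod[of "e i" "\<lambda>_. 0", OF e_le]
    by (simp add: prod_gauss_moment e)
  show "has_bochner_integral std_complex_normal (\<lambda>z. z $ i * cnj (z $ j)) (if i = j then 1 else 0)"
    using has_bochner_integral_std_complex_normal_prod[of "e i" "e j", OF e_le e_le]
    by (simp only: prod_gauss_moment prod.distrib e e_eq fact_e prod.neutral_const)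
  let ?p = "\<lambda>m. e i m + e k m" and ?q = "\<lambda>m. e j m + e l m"
  have le: "?p m \<le> 2" "?q m \<le> 2" for m by (auto simp: e_def)
  have eq: "?p = ?q \<longleftrightarrow> i = j \<and> k = l \<or> i = l \<and> k = j"
  proof
    assume *: "?p = ?q"
    then have "e i i + e k i = e j i + e l i" by (rule fun_cong)
    then have "i = j \<or> i = l" by (auto simp: e_def split: if_splits)
    then show "i = j \<and> k = l \<or> i = l \<and> k = j"
    proof
      assume ij: "i = j"
      then have "e k = e l" using * by (auto simp: fun_eq_iff)
      then show ?thesis using ij by (simp add: e_eq)
    next
      assume il: "i = l"
      then have "e k = e j" using * by (auto simp: fun_eq_iff)
      then show ?thesis using il by (simp add: e_eq)
    qed
  qed (auto simp: add.commute)
  have "(\<Prod>m\<in>UNIV. fact (?p m)) = (if i = k then 2 else 1 :: complex)"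
  proof (cases "i = k")
    case True
    have "(\<Prod>m\<in>UNIV. fact (?p m)) = (\<Prod>m\<in>UNIV. 2 ^ e i m :: complex)"
      using True by (intro prod.cong) (auto simp: e_def)
    then show ?thesis using True by (simp add: e)
  next
    case False
    have "fact (?p m) = (1::complex)" for m using False by (auto simp: e_def)
    then show ?thesis using False by simp
  qed
  then have "(\<Prod>m\<in>UNIV. gauss_moment (?p m) (?q m)) =
      (if i = j then 1 else 0) * (if k = l then 1 else 0) + (if i = l then 1 else 0) * (if k = j then 1 else 0)"
    unfolding prod_gauss_moment eq by auto
  then show "has_bochner_integral std_complex_normal (\<lambda>z. z $ i * cnj (z $ j) * z $ k * cnj (z $ l))
      ((if i = j then 1 else 0) * (if k = l then 1 else 0) + (if i = l then 1 else 0) * (if k = j then 1 else 0))"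
    using has_bochner_integral_std_complex_normal_prod[of ?p ?q, OF le]
    by (simp only: prod.distrib power_add e mult_ac)
qed

lemma borel_measurable_matrix_vector_mult [measurable (raw)]:
  fixes A :: "complex^'n^'m"
  assumes "f \<in> borel_measurable M"
  shows "(\<lambda>x. A *v f x) \<in> borel_measurable M"
  using assms unfolding matrix_vector_mult_def
  by (intro borel_measurable_vec_lambda) measurable

lemma complex_normal_rv_has_bochner_integral:
  fixes X :: "'w \<Rightarrow> complex^'n"
  assumes "X \<in> borel_measurable \<Omega>" "distr \<Omega> borel X = distr std_complex_normal borel (\<lambda>z. A *v z)"
    and [measurable]: "f \<in> borel_measurable borel"
    and "has_bochner_integral std_complex_normal (\<lambda>z. f (A *v z)) v"
  shows "has_bochner_integral \<Omega> (\<lambda>\<omega>. f (X \<omega>) :: complex) v"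
proof -
  have [measurable]: "X \<in> borel_measurable \<Omega>" by fact
  have [measurable]: "(\<lambda>z. A *v z) \<in> std_complex_normal \<rightarrow>\<^sub>M borel"
    by (simp add: std_complex_normal_def)
  have "has_bochner_integral (distr \<Omega> borel X) f v"
    unfolding assms(2) by (intro has_bochner_integral_distr) (use assms(4) in auto)
  then show ?thesis
    by (simp add: has_bochner_integral_iff integrable_distr_eq integral_distr)
qed

lemma product_of_four_sums:
  fixes f g h k :: "'n::finite \<Rightarrow> 'a::comm_ring_1"
  shows "sum f UNIV * sum g UNIV * sum h UNIV * sum k UNIV =
    (\<Sum>a\<in>UNIV. \<Sum>b\<in>UNIV. \<Sum>c\<in>UNIV. \<Sum>d\<in>UNIV. f a * g b * h c * k d)"
  by (simp flip: sum_distrib_left sum_distrib_right)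

lemma sum_pairings:
  fixes f :: "'n::finite \<Rightarrow> 'n \<Rightarrow> 'n \<Rightarrow> 'n \<Rightarrow> complex"
  shows "(\<Sum>a\<in>UNIV. \<Sum>b\<in>UNIV. \<Sum>c\<in>UNIV. \<Sum>d\<in>UNIV. f a b c d *
       ((if a = b then 1 else 0) * (if c = d then 1 else 0) + (if a = d then 1 else 0) * (if c = b then 1 else 0))) =
     (\<Sum>a\<in>UNIV. \<Sum>c\<in>UNIV. f a a c c) + (\<Sum>a\<in>UNIV. \<Sum>b\<in>UNIV. f a b b a)"
proof -
  have 1: "f a b c d * ((if a = b then 1 else 0) * (if c = d then 1 else 0) + (if a = d then 1 else 0) * (if c = b then 1 else 0))
    = (if c = d then if a = b then f a b c c else 0 else 0) + (if a = d then if c = b then f a b b a else 0 else 0)" for a b c d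
    by auto
  have 2: "(\<Sum>b\<in>UNIV. \<Sum>c\<in>UNIV. if a = b then f a b c c else 0) = (\<Sum>c\<in>UNIV. f a a c c)" for a
    by (subst sum.swap) simp
  show ?thesis unfolding 1 by (simp add: sum.distrib 2)
qed

lemma complex_normal_rv_moments:
  fixes X :: "'w \<Rightarrow> complex^'n"
  assumes "complex_normal_rv \<Omega> X R"
  shows "has_bochner_integral \<Omega> (\<lambda>\<omega>. X \<omega> $ i) 0"
    and "has_bochner_integral \<Omega> (\<lambda>\<omega>. X \<omega> $ i * cnj (X \<omega> $ j)) (R $ i $ j)"
    and "has_bochner_integral \<Omega> (\<lambda>\<omega>. X \<omega> $ i * cnj (X \<omega> $ j) * X \<omega> $ k * cnj (X \<omega> $ l))
      (R $ i $ j * R $ k $ l + R $ i $ l * R $ k $ j)"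
proof -
  obtain A :: "complex^'n^'n" where A: "A ** hermitian_transpose A = R"
    and d: "distr \<Omega> borel X = distr std_complex_normal borel (\<lambda>z. A *v z)"
    using assms by (auto simp: complex_normal_rv_def)
  have X: "X \<in> borel_measurable \<Omega>" using assms by (simp add: complex_normal_rv_def)
  note tr = complex_normal_rv_has_bochner_integral[OF X d]
  have R: "R $ i $ j = (\<Sum>a\<in>UNIV. A $ i $ a * cnj (A $ j $ a))" for i j
    unfolding A[symmetric] by (simp add: matrix_matrix_mult_def hermitian_transpose_def)
  have "has_bochner_integral std_complex_normal (\<lambda>z. \<Sum>a\<in>UNIV. A $ i $ a * z $ a)
      (\<Sum>a\<in>UNIV. A $ i $ a * 0)"
    by (intro has_bochner_integral_sum has_bochner_integral_mult_right std_complex_normal_moments)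
  then show "has_bochner_integral \<Omega> (\<lambda>\<omega>. X \<omega> $ i) 0"
    by (intro tr) (auto simp: matrix_vector_mult_def)
  have "has_bochner_integral std_complex_normal
      (\<lambda>z. \<Sum>a\<in>UNIV. \<Sum>b\<in>UNIV. (A $ i $ a * cnj (A $ j $ b)) * (z $ a * cnj (z $ b)))
      (\<Sum>a\<in>UNIV. \<Sum>b\<in>UNIV. (A $ i $ a * cnj (A $ j $ b)) * (if a = b then 1 else 0))"
    by (intro has_bochner_integral_sum has_bochner_integral_mult_right std_complex_normal_moments)
  then show "has_bochner_integral \<Omega> (\<lambda>\<omega>. X \<omega> $ i * cnj (X \<omega> $ j)) (R $ i $ j)"
    by (intro tr) (auto simp: matrix_vector_mult_def R sum_product mult_ac if_distrib cong: if_cong)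
  let ?d = "\<lambda>a b :: 'n. if a = b then 1 else 0 :: complex"
  let ?c = "\<lambda>a b c d. A $ i $ a * cnj (A $ j $ b) * A $ k $ c * cnj (A $ l $ d)"
  have "has_bochner_integral std_complex_normal
      (\<lambda>z. \<Sum>a\<in>UNIV. \<Sum>b\<in>UNIV. \<Sum>c\<in>UNIV. \<Sum>d\<in>UNIV.
        ?c a b c d * (z $ a * cnj (z $ b) * z $ c * cnj (z $ d)))
      (\<Sum>a\<in>UNIV. \<Sum>b\<in>UNIV. \<Sum>c\<in>UNIV. \<Sum>d\<in>UNIV.
        ?c a b c d * (?d a b * ?d c d + ?d a d * ?d c b))"
    by (intro has_bochner_integral_sum has_bochner_integral_mult_right std_complex_normal_moments)
  also have "(\<lambda>z. \<Sum>a\<in>UNIV. \<Sum>b\<in>UNIV. \<Sum>c\<in>UNIV. \<Sum>d\<in>UNIV.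
        ?c a b c d * (z $ a * cnj (z $ b) * z $ c * cnj (z $ d))) =
      (\<lambda>z. (A *v z) $ i * cnj ((A *v z) $ j) * (A *v z) $ k * cnj ((A *v z) $ l))"
    unfolding matrix_vector_mult_def vec_lambda_beta cnj_sum product_of_four_sums
    by (rule ext, (rule sum.cong[OF refl])+) (simp only: complex_cnj_mult mult_ac)
  also have "(\<Sum>a\<in>UNIV. \<Sum>b\<in>UNIV. \<Sum>c\<in>UNIV. \<Sum>d\<in>UNIV.
        ?c a b c d * (?d a b * ?d c d + ?d a d * ?d c b)) = 
      (\<Sum>a\<in>UNIV. \<Sum>c\<in>UNIV. ?c a a c c) + (\<Sum>a\<in>UNIV. \<Sum>b\<in>UNIV. ?c a b b a)"
    by (rule sum_pairings)
  also have "(\<Sum>a\<in>UNIV. \<Sum>c\<in>UNIV. ?c a a c c) = R $ i $ j * R $ k $ l"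
    by (simp add: R sum_product mult_ac)
  also have "(\<Sum>a\<in>UNIV. \<Sum>b\<in>UNIV. ?c a b b a) = R $ i $ l * R $ k $ j"
    by (simp add: R sum_product mult_ac)
  finally show "has_bochner_integral \<Omega> (\<lambda>\<omega>. X \<omega> $ i * cnj (X \<omega> $ j) * X \<omega> $ k * cnj (X \<omega> $ l))
      (R $ i $ j * R $ k $ l + R $ i $ l * R $ k $ j)"
    by (intro tr) auto
qed

subsection \<open>Vectors with given mean and covariance\<close>

text \<open>\<open>X\<close> is centred and square integrable, with covariance matrix \<open>C = E (X X\<^sup>H)\<close>.\<close>

definition second_order :: "'w measure \<Rightarrow> ('w \<Rightarrow> complex^'n) \<Rightarrow> complex^'n^'n \<Rightarrow> bool" where
  "second_order M X C \<longleftrightarrow> X \<in> borel_measurable M \<and>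
     (\<forall>i. has_bochner_integral M (\<lambda>\<omega>. X \<omega> $ i) 0) \<and>
     (\<forall>i j. has_bochner_integral M (\<lambda>\<omega>. X \<omega> $ i * cnj (X \<omega> $ j)) (C $ i $ j))"

lemma second_order_zero: "second_order M (\<lambda>_. 0) 0"
  by (simp add: second_order_def has_bochner_integral_zero)

lemma complex_normal_rv_second_order:
  "complex_normal_rv M X R \<Longrightarrow> second_order M X R"
  by (simp add: second_order_def complex_normal_rv_moments) (simp add: complex_normal_rv_def)

lemma second_order_scaleR:
  assumes "second_order M X C"
  shows "second_order M (\<lambda>\<omega>. c *\<^sub>R X \<omega>) (c\<^sup>2 *\<^sub>R C)"
  unfolding second_order_def
proof (intro conjI allI)
  have X: "X \<in> borel_measurable M"
    "\<And>i. has_bochner_integral M (\<lambda>\<omega>. X \<omega> $ i) 0"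
    "\<And>i j. has_bochner_integral M (\<lambda>\<omega>. X \<omega> $ i * cnj (X \<omega> $ j)) (C $ i $ j)"
    using assms by (auto simp: second_order_def)
  show "(\<lambda>\<omega>. c *\<^sub>R X \<omega>) \<in> borel_measurable M" using X(1) by measurable
  show "has_bochner_integral M (\<lambda>\<omega>. (c *\<^sub>R X \<omega>) $ i) 0" for i
    using has_bochner_integral_scaleR_right[OF X(2), of c i] by simp
  show "has_bochner_integral M (\<lambda>\<omega>. (c *\<^sub>R X \<omega>) $ i * cnj ((c *\<^sub>R X \<omega>) $ j)) ((c\<^sup>2 *\<^sub>R C) $ i $ j)" for i j
    using has_bochner_integral_scaleR_right[OF X(3), of "c\<^sup>2" i j] by (simp add: power2_eq_square)
qed

lemma second_order_matrix_mult:
  fixes B :: "complex^'n^'n"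
  assumes "second_order M X C"
  shows "second_order M (\<lambda>\<omega>. B *v X \<omega>) (B ** C ** hermitian_transpose B)"
  unfolding second_order_def
proof (intro conjI allI)
  have X: "X \<in> borel_measurable M"
    "\<And>i. has_bochner_integral M (\<lambda>\<omega>. X \<omega> $ i) 0"
    "\<And>i j. has_bochner_integral M (\<lambda>\<omega>. X \<omega> $ i * cnj (X \<omega> $ j)) (C $ i $ j)"
    using assms by (auto simp: second_order_def)
  show "(\<lambda>\<omega>. B *v X \<omega>) \<in> borel_measurable M" using X(1) by measurable
  fix i
  have "has_bochner_integral M (\<lambda>\<omega>. \<Sum>a\<in>UNIV. B $ i $ a * X \<omega> $ a) (\<Sum>a\<in>UNIV. B $ i $ a * 0)"
    by (intro has_bochner_integral_sum has_bochner_integral_mult_right X)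
  then show "has_bochner_integral M (\<lambda>\<omega>. (B *v X \<omega>) $ i) 0"
    by (simp add: matrix_vector_mult_def)
  fix j
  have "has_bochner_integral M
      (\<lambda>\<omega>. \<Sum>b\<in>UNIV. \<Sum>a\<in>UNIV. (B $ i $ a * cnj (B $ j $ b)) * (X \<omega> $ a * cnj (X \<omega> $ b)))
      (\<Sum>b\<in>UNIV. \<Sum>a\<in>UNIV. (B $ i $ a * cnj (B $ j $ b)) * C $ a $ b)"
    by (intro has_bochner_integral_sum has_bochner_integral_mult_right X)
  also have "(\<lambda>\<omega>. \<Sum>b\<in>UNIV. \<Sum>a\<in>UNIV. (B $ i $ a * cnj (B $ j $ b)) * (X \<omega> $ a * cnj (X \<omega> $ b)))
      = (\<lambda>\<omega>. (B *v X \<omega>) $ i * cnj ((B *v X \<omega>) $ j))"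
    unfolding matrix_vector_mult_def vec_lambda_beta cnj_sum sum_product
    by (rule ext, subst sum.swap, (rule sum.cong[OF refl])+) (simp only: complex_cnj_mult mult_ac)
  also have "(\<Sum>b\<in>UNIV. \<Sum>a\<in>UNIV. (B $ i $ a * cnj (B $ j $ b)) * C $ a $ b)
      = (B ** C ** hermitian_transpose B) $ i $ j"
    unfolding matrix_matrix_mult_def hermitian_transpose_def vec_lambda_beta sum_distrib_right
    by ((rule sum.cong[OF refl])+) (simp only: mult_ac)
  finally show "has_bochner_integral M (\<lambda>\<omega>. (B *v X \<omega>) $ i * cnj ((B *v X \<omega>) $ j))
      ((B ** C ** hermitian_transpose B) $ i $ j)" .
qed

lemma second_order_norm:
  fixes X :: "'w \<Rightarrow> complex^'n"
  assumes "second_order M X C"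
  shows "has_bochner_integral M (\<lambda>\<omega>. complex_of_real ((norm (X \<omega>))\<^sup>2)) (trace C)"
proof -
  have "has_bochner_integral M (\<lambda>\<omega>. \<Sum>i\<in>UNIV. X \<omega> $ i * cnj (X \<omega> $ i)) (\<Sum>i\<in>UNIV. C $ i $ i)"
    using assms by (intro has_bochner_integral_sum) (auto simp: second_order_def)
  then show ?thesis
    by (simp add: trace_def norm_vec_def L2_set_def sum_nonneg flip: complex_norm_square)
qed

lemma has_bochner_integral_cnj:
  assumes "has_bochner_integral M f a"
  shows "has_bochner_integral M (\<lambda>\<omega>. cnj (f \<omega>)) (cnj a)"
  using assms by (simp add: has_bochner_integral_iff)

context prob_space
begin

lemma indep_var_has_bochner_integral_mult:
  fixes f :: "'b::topological_space \<Rightarrow> complex" and g :: "'b \<Rightarrow> complex"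
  assumes "indep_var borel X borel Y"
    and f: "f \<in> borel_measurable borel" and g: "g \<in> borel_measurable borel"
    and "has_bochner_integral M (\<lambda>\<omega>. f (X \<omega>)) a" "has_bochner_integral M (\<lambda>\<omega>. g (Y \<omega>)) b"
  shows "has_bochner_integral M (\<lambda>\<omega>. f (X \<omega>) * g (Y \<omega>)) (a * b)"
proof -
  have "indep_var borel (f \<circ> X) borel (g \<circ> Y)"
    by (rule indep_var_compose[OF assms(1) f g])
  then have "indep_var borel (\<lambda>\<omega>. f (X \<omega>)) borel (\<lambda>\<omega>. g (Y \<omega>))"
    by (simp add: comp_def)
  from indep_var_integrable[OF this] indep_var_lebesgue_integral[OF this] assms(4,5)
  show ?thesis by (simp add: has_bochner_integral_iff)
qed

lemma second_order_add_indep: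
  fixes X Y :: "'a \<Rightarrow> complex^'n"
  assumes indep: "indep_var borel X borel Y"
    and "second_order M X C" "second_order M Y D"
  shows "second_order M (\<lambda>\<omega>. X \<omega> + Y \<omega>) (C + D)"
  unfolding second_order_def
proof (intro conjI allI)
  have X: "X \<in> borel_measurable M"
    "\<And>i. has_bochner_integral M (\<lambda>\<omega>. X \<omega> $ i) 0"
    "\<And>i j. has_bochner_integral M (\<lambda>\<omega>. X \<omega> $ i * cnj (X \<omega> $ j)) (C $ i $ j)"
    using assms(2) by (auto simp: second_order_def)
  have Y: "Y \<in> borel_measurable M"
    "\<And>i. has_bochner_integral M (\<lambda>\<omega>. Y \<omega> $ i) 0"
    "\<And>i j. has_bochner_integral M (\<lambda>\<omega>. Y \<omega> $ i * cnj (Y \<omega> $ j)) (D $ i $ j)"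
    using assms(3) by (auto simp: second_order_def)
  show "(\<lambda>\<omega>. X \<omega> + Y \<omega>) \<in> borel_measurable M" using X(1) Y(1) by measurable
  show "has_bochner_integral M (\<lambda>\<omega>. (X \<omega> + Y \<omega>) $ i) 0" for i
    using has_bochner_integral_add[OF X(2) Y(2), of i i] by simp
  fix i j
  have 1: "has_bochner_integral M (\<lambda>\<omega>. X \<omega> $ i * cnj (Y \<omega> $ j)) 0" for i j
    using indep_var_has_bochner_integral_mult[OF indep, of "\<lambda>x. x $ i" "\<lambda>x. cnj (x $ j)"
        0 0] X(2)[of i] has_bochner_integral_cnj[OF Y(2)[of j]] by simp
  have "has_bochner_integral M (\<lambda>\<omega>. X \<omega> $ i * cnj (X \<omega> $ j) + X \<omega> $ i * cnj (Y \<omega> $ j)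
      + cnj (X \<omega> $ j * cnj (Y \<omega> $ i)) + Y \<omega> $ i * cnj (Y \<omega> $ j)) (C $ i $ j + 0 + cnj 0 + D $ i $ j)"
    by (intro has_bochner_integral_add X Y 1 has_bochner_integral_cnj)
  then show "has_bochner_integral M (\<lambda>\<omega>. (X \<omega> + Y \<omega>) $ i * cnj ((X \<omega> + Y \<omega>) $ j)) ((C + D) $ i $ j)"
    by (simp add: algebra_simps)
qed

lemma indep_var_weighted_sum:
  fixes X :: "'i \<Rightarrow> 'a \<Rightarrow> 'b::{real_normed_vector, second_countable_topology}"
  assumes I: "finite I" "i \<notin> I" and indep: "indep_vars (\<lambda>_. borel) X (insert i I)"
  shows "indep_var borel (X i) borel (\<lambda>\<omega>. \<Sum>i\<in>I. c i *\<^sub>R X i \<omega>)"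
proof -
  have "indep_var
    borel ((\<lambda>f. f i) \<circ> (\<lambda>\<omega>. restrict (\<lambda>i. X i \<omega>) {i}))
    borel ((\<lambda>f. \<Sum>i\<in>I. c i *\<^sub>R f i) \<circ> (\<lambda>\<omega>. restrict (\<lambda>i. X i \<omega>) I))"
    using I by (intro indep_var_compose[OF indep_var_restrict[OF indep]]) auto
  also have "((\<lambda>f. f i) \<circ> (\<lambda>\<omega>. restrict (\<lambda>i. X i \<omega>) {i})) = X i"
    by auto
  also have "((\<lambda>f. \<Sum>i\<in>I. c i *\<^sub>R f i) \<circ> (\<lambda>\<omega>. restrict (\<lambda>i. X i \<omega>) I)) = (\<lambda>\<omega>. \<Sum>i\<in>I. c i *\<^sub>R X i \<omega>)"
    by auto
  finally show ?thesis .
qed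

lemma second_order_weighted_sum:
  fixes X :: "'i \<Rightarrow> 'a \<Rightarrow> complex^'n"
  assumes "finite I" "indep_vars (\<lambda>_. borel) X I" "\<And>i. i \<in> I \<Longrightarrow> second_order M (X i) (C i)"
  shows "second_order M (\<lambda>\<omega>. \<Sum>i\<in>I. c i *\<^sub>R X i \<omega>) (\<Sum>i\<in>I. (c i)\<^sup>2 *\<^sub>R C i)"
  using assms
proof (induction I rule: finite_induct)
  case empty
  then show ?case by (simp add: second_order_zero)
next
  case (insert i I)
  have "indep_vars (\<lambda>_. borel) X I"
    using insert.prems(1) by (rule indep_vars_subset) auto
  then have IH: "second_order M (\<lambda>\<omega>. \<Sum>i\<in>I. c i *\<^sub>R X i \<omega>) (\<Sum>i\<in>I. (c i)\<^sup>2 *\<^sub>R C i)"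
    using insert by auto
  have "indep_var borel ((\<lambda>x. c i *\<^sub>R x) \<circ> X i) borel ((\<lambda>x. x) \<circ> (\<lambda>\<omega>. \<Sum>i\<in>I. c i *\<^sub>R X i \<omega>))"
    by (rule indep_var_compose[OF indep_var_weighted_sum[OF insert.hyps insert.prems(1)]]) auto
  then have "indep_var borel (\<lambda>\<omega>. c i *\<^sub>R X i \<omega>) borel (\<lambda>\<omega>. \<Sum>i\<in>I. c i *\<^sub>R X i \<omega>)"
    by (simp add: comp_def)
  from second_order_add_indep[OF this second_order_scaleR IH] insert show ?case by simp
qed

end

lemma trace_congruence_expand:
  fixes B C R :: "complex^'n^'n"
  shows "trace (B ** C ** hermitian_transpose B ** R) =
    (\<Sum>i\<in>UNIV. \<Sum>j\<in>UNIV. \<Sum>k\<in>UNIV. \<Sum>l\<in>UNIV. B $ i $ j * cnj (B $ k $ l) * (R $ k $ i * C $ j $ l))"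
proof -
  have "trace (B ** C ** hermitian_transpose B ** R) =
    (\<Sum>i\<in>UNIV. \<Sum>k\<in>UNIV. \<Sum>l\<in>UNIV. \<Sum>j\<in>UNIV. B $ i $ j * cnj (B $ k $ l) * (R $ k $ i * C $ j $ l))"
    unfolding trace_def matrix_matrix_mult_def hermitian_transpose_def vec_lambda_beta sum_distrib_right
    by ((rule sum.cong[OF refl])+) (simp only: mult_ac)
  also have "\<dots> = (\<Sum>i\<in>UNIV. \<Sum>k\<in>UNIV. \<Sum>j\<in>UNIV. \<Sum>l\<in>UNIV. B $ i $ j * cnj (B $ k $ l) * (R $ k $ i * C $ j $ l))"
    by (rule sum.cong[OF refl], rule sum.cong[OF refl], rule sum.swap)
  also have "\<dots> = (\<Sum>i\<in>UNIV. \<Sum>j\<in>UNIV. \<Sum>k\<in>UNIV. \<Sum>l\<in>UNIV. B $ i $ j * cnj (B $ k $ l) * (R $ k $ i * C $ j $ l))"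
    by (rule sum.cong[OF refl], rule sum.swap)
  finally show ?thesis .
qed

subsection \<open>Sesquilinear forms in complex normal vectors\<close>

lemma matrix_vector_mult_scaleR_right:
  fixes A :: "complex^'n^'m"
  shows "A *v (c *\<^sub>R x) = c *\<^sub>R (A *v x)"
  by (simp add: vec_eq_iff matrix_vector_mult_def scaleR_sum_right)

lemma matrix_mult_scaleR_right:
  fixes A :: "complex^'n^'m" and B :: "complex^'k^'n"
  shows "A ** (c *\<^sub>R B) = c *\<^sub>R (A ** B)"
  by (simp add: vec_eq_iff matrix_matrix_mult_def scaleR_sum_right)

lemma matrix_mult_scaleR_left:
  fixes A :: "complex^'n^'m" and B :: "complex^'k^'n"
  shows "(c *\<^sub>R A) ** B = c *\<^sub>R (A ** B)"
  by (simp add: vec_eq_iff matrix_matrix_mult_def scaleR_sum_right)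

lemma matrix_add_rdistrib: "((A :: complex^'n^'m) + B) ** C = A ** C + B ** C"
  by (simp add: vec_eq_iff matrix_matrix_mult_def distrib_right sum.distrib)

lemma trace_scaleR: "trace (c *\<^sub>R A) = complex_of_real c * trace (A :: complex^'n^'n)"
  unfolding trace_def vector_scaleR_component by (simp add: scaleR_conv_of_real sum_distrib_left)

lemma herm_prod_add_right: "herm_prod x (y + z) = herm_prod x y + herm_prod x z"
  by (simp add: herm_prod_def distrib_left sum.distrib)

lemma herm_prod_scaleR_right: "herm_prod x (c *\<^sub>R y) = complex_of_real c * herm_prod x y"
  unfolding herm_prod_def vector_scaleR_component by (simp add: scaleR_conv_of_real sum_distrib_left mult_ac)

lemma herm_prod_matrix_expand:
  "herm_prod x (B *v y) = (\<Sum>i\<in>UNIV. \<Sum>j\<in>UNIV. B $ i $ j * (cnj (x $ i) * y $ j))"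
  unfolding herm_prod_def matrix_vector_mult_def vec_lambda_beta sum_distrib_left
  by ((rule sum.cong[OF refl])+) (simp only: mult_ac)

lemma borel_measurable_herm_prod [measurable (raw)]:
  assumes "f \<in> borel_measurable M" "g \<in> borel_measurable M"
  shows "(\<lambda>x. herm_prod (f x) (g x)) \<in> borel_measurable M"
  using assms unfolding herm_prod_def by measurable

lemma product_of_two_double_sums:
  fixes f g :: "'n::finite \<Rightarrow> 'n \<Rightarrow> 'a::comm_ring_1"
  shows "(\<Sum>i\<in>UNIV. \<Sum>j\<in>UNIV. f i j) * (\<Sum>k\<in>UNIV. \<Sum>l\<in>UNIV. g k l) =
    (\<Sum>i\<in>UNIV. \<Sum>j\<in>UNIV. \<Sum>k\<in>UNIV. \<Sum>l\<in>UNIV. f i j * g k l)"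
  by (simp flip: sum_distrib_left sum_distrib_right)

lemma sesquilinear_times_cnj:
  fixes B :: "complex^'n^'n"
  shows "herm_prod x (B *v y) * cnj (herm_prod u (B *v v)) =
    (\<Sum>i\<in>UNIV. \<Sum>j\<in>UNIV. \<Sum>k\<in>UNIV. \<Sum>l\<in>UNIV.
       B $ i $ j * cnj (B $ k $ l) * (u $ k * cnj (x $ i) * (y $ j * cnj (v $ l))))"
  unfolding herm_prod_matrix_expand cnj_sum product_of_two_double_sums
  by ((rule sum.cong[OF refl])+) (simp add: mult_ac)

lemma trace_product_expand:
  fixes B R :: "complex^'n^'n"
  shows "trace (B ** R) = (\<Sum>i\<in>UNIV. \<Sum>j\<in>UNIV. B $ i $ j * R $ j $ i)"
  by (simp add: trace_def matrix_matrix_mult_def)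

lemma psd_entry_cnj: "positive_semidefinite R \<Longrightarrow> cnj (R $ i $ j) = R $ j $ i"
  unfolding positive_semidefinite_def hermitian_transpose_def vec_eq_iff vec_lambda_beta by blast

lemma complex_normal_rv_quadratic_form:
  fixes X :: "'w \<Rightarrow> complex^'n"
  assumes X: "complex_normal_rv M X R" and R: "positive_semidefinite R"
  shows "has_bochner_integral M (\<lambda>\<omega>. herm_prod (X \<omega>) (B *v X \<omega>) * cnj (herm_prod (X \<omega>) (B *v X \<omega>)))
     (complex_of_real ((cmod (trace (B ** R)))\<^sup>2) + trace (B ** R ** hermitian_transpose B ** R))"
proof -
  have 1: "has_bochner_integral M (\<lambda>\<omega>. X \<omega> $ k * cnj (X \<omega> $ i) * (X \<omega> $ j * cnj (X \<omega> $ l)))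
      (R $ k $ i * R $ j $ l + R $ k $ l * R $ j $ i)" for i j k l
    using complex_normal_rv_moments(3)[OF X, of k i j l] by (simp add: mult_ac)
  have "has_bochner_integral M (\<lambda>\<omega>. herm_prod (X \<omega>) (B *v X \<omega>) * cnj (herm_prod (X \<omega>) (B *v X \<omega>)))
    (\<Sum>i\<in>UNIV. \<Sum>j\<in>UNIV. \<Sum>k\<in>UNIV. \<Sum>l\<in>UNIV.
       B $ i $ j * cnj (B $ k $ l) * (R $ k $ i * R $ j $ l + R $ k $ l * R $ j $ i))"
    unfolding sesquilinear_times_cnj
    by (intro has_bochner_integral_sum has_bochner_integral_mult_right 1)
  also have "(\<Sum>i\<in>UNIV. \<Sum>j\<in>UNIV. \<Sum>k\<in>UNIV. \<Sum>l\<in>UNIV.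
       B $ i $ j * cnj (B $ k $ l) * (R $ k $ i * R $ j $ l + R $ k $ l * R $ j $ i)) =
     trace (B ** R ** hermitian_transpose B ** R) +
     (\<Sum>i\<in>UNIV. \<Sum>j\<in>UNIV. \<Sum>k\<in>UNIV. \<Sum>l\<in>UNIV. B $ i $ j * cnj (B $ k $ l) * (R $ k $ l * R $ j $ i))"
    unfolding trace_congruence_expand by (simp only: distrib_left sum.distrib)
  also have "(\<Sum>i\<in>UNIV. \<Sum>j\<in>UNIV. \<Sum>k\<in>UNIV. \<Sum>l\<in>UNIV. B $ i $ j * cnj (B $ k $ l) * (R $ k $ l * R $ j $ i))
     = trace (B ** R) * cnj (trace (B ** R))"
    unfolding trace_product_expand cnj_sum product_of_two_double_sums
    by ((rule sum.cong[OF refl])+) (simp add: psd_entry_cnj[OF R])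
  finally show ?thesis by (simp add: add.commute flip: complex_norm_square)
qed

lemma (in prob_space) second_order_indep_sesquilinear_form:
  fixes X Y :: "'a \<Rightarrow> complex^'n"
  assumes X: "second_order M X R" and Y: "second_order M Y C"
    and indep: "indep_var borel X borel Y"
  shows "has_bochner_integral M (\<lambda>\<omega>. herm_prod (X \<omega>) (B *v Y \<omega>) * cnj (herm_prod (X \<omega>) (B *v Y \<omega>)))
     (trace (B ** C ** hermitian_transpose B ** R))"
proof -
  have 1: "has_bochner_integral M (\<lambda>\<omega>. X \<omega> $ k * cnj (X \<omega> $ i) * (Y \<omega> $ j * cnj (Y \<omega> $ l)))
      (R $ k $ i * C $ j $ l)" for i j k l
    using indep_var_has_bochner_integral_mult[OF indep, of "\<lambda>x. x $ k * cnj (x $ i)" "\<lambda>x. x $ j * cnj (x $ l)"]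
      X Y by (simp add: second_order_def)
  show ?thesis
    unfolding sesquilinear_times_cnj trace_congruence_expand
    by (intro has_bochner_integral_sum has_bochner_integral_mult_right 1)
qed

lemma integrable_mult_cnj:
  fixes f g :: "'a \<Rightarrow> complex"
  assumes [measurable]: "f \<in> borel_measurable M" "g \<in> borel_measurable M"
    and "integrable M (\<lambda>x. f x * cnj (f x))" "integrable M (\<lambda>x. g x * cnj (g x))"
  shows "integrable M (\<lambda>x. f x * g x)"
proof (rule Bochner_Integration.integrable_bound)
  show "integrable M (\<lambda>x. norm (f x * cnj (f x)) + norm (g x * cnj (g x)))"
    using assms by (intro Bochner_Integration.integrable_add integrable_norm)
  have "norm (f x * g x) \<le> norm (f x * cnj (f x)) + norm (g x * cnj (g x))" for x
    using sum_squares_bound[of "cmod (f x)" "cmod (g x)"]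
      mult_nonneg_nonneg[OF norm_ge_zero norm_ge_zero, of "f x" "g x"]
    unfolding norm_mult complex_mod_cnj power2_eq_square by linarith
  then show "AE x in M. norm (f x * g x) \<le> norm (norm (f x * cnj (f x)) + norm (g x * cnj (g x)))"
    by (auto intro: order_trans)
qed measurable

lemma cmod_square_real_combination:
  "complex_of_real (c\<^sup>2) * (s * cnj s) + complex_of_real c * (s * cnj u)
      + complex_of_real c * cnj (s * cnj u) + u * cnj u
    = complex_of_real ((cmod (complex_of_real c * s + u))\<^sup>2)"
  unfolding complex_norm_square by (simp add: algebra_simps power2_eq_square)

lemma (in prob_space) complex_normal_rv_contaminated_form:
  fixes X Y :: "'a \<Rightarrow> complex^'n"
  assumes X: "complex_normal_rv M X R" and R: "positive_semidefinite R"
    and Y: "second_order M Y C" and indep: "indep_var borel X borel Y"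
  shows "has_bochner_integral M (\<lambda>\<omega>. complex_of_real ((cmod (herm_prod (X \<omega>) (B *v (c *\<^sub>R X \<omega> + Y \<omega>))))\<^sup>2))
     (complex_of_real (c\<^sup>2 * (cmod (trace (B ** R)))\<^sup>2)
        + trace (B ** (c\<^sup>2 *\<^sub>R R + C) ** hermitian_transpose B ** R))"
proof -
  let ?S = "\<lambda>\<omega>. herm_prod (X \<omega>) (B *v X \<omega>)" and ?U = "\<lambda>\<omega>. herm_prod (X \<omega>) (B *v Y \<omega>)"
  have Xs: "second_order M X R" using X by (rule complex_normal_rv_second_order)
  then have Xm[measurable]: "X \<in> borel_measurable M" by (simp add: second_order_def)
  have SS: "has_bochner_integral M (\<lambda>\<omega>. ?S \<omega> * cnj (?S \<omega>))
     (complex_of_real ((cmod (trace (B ** R)))\<^sup>2) + trace (B ** R ** hermitian_transpose B ** R))"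
    by (rule complex_normal_rv_quadratic_form[OF X R])
  have UU: "has_bochner_integral M (\<lambda>\<omega>. ?U \<omega> * cnj (?U \<omega>)) (trace (B ** C ** hermitian_transpose B ** R))"
    by (rule second_order_indep_sesquilinear_form[OF Xs Y indep])
  have "has_bochner_integral M (\<lambda>\<omega>. ?S \<omega> * X \<omega> $ i * cnj (Y \<omega> $ j)) 0" for i j
  proof -
    have XX: "integrable M (\<lambda>\<omega>. X \<omega> $ i * cnj (X \<omega> $ i))"
      using Xs by (auto simp: second_order_def has_bochner_integral_iff)
    have "integrable M (\<lambda>\<omega>. ?S \<omega> * X \<omega> $ i)"
      by (rule integrable_mult_cnj[where f = ?S and g = "\<lambda>\<omega>. X \<omega> $ i", OF _ _ integrable.intros[OF SS] XX])
        measurable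
    then obtain v where "has_bochner_integral M (\<lambda>\<omega>. ?S \<omega> * X \<omega> $ i) v"
      by (auto simp: integrable.simps)
    moreover have "has_bochner_integral M (\<lambda>\<omega>. cnj (Y \<omega> $ j)) (cnj 0)"
      using Y by (intro has_bochner_integral_cnj) (simp add: second_order_def)
    ultimately have "has_bochner_integral M (\<lambda>\<omega>. ?S \<omega> * X \<omega> $ i * cnj (Y \<omega> $ j)) (v * cnj 0)"
      by (rule indep_var_has_bochner_integral_mult[OF indep, of "\<lambda>x. herm_prod x (B *v x) * x $ i" "\<lambda>x. cnj (x $ j)", rotated 2])
        measurable
    then show ?thesis by simp
  qed
  note 1 = this
  have "has_bochner_integral M (\<lambda>\<omega>. \<Sum>i\<in>UNIV. \<Sum>j\<in>UNIV. cnj (B $ i $ j) * (?S \<omega> * X \<omega> $ i * cnj (Y \<omega> $ j)))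
     (\<Sum>i\<in>UNIV. \<Sum>j\<in>UNIV. cnj (B $ i $ j) * 0)"
    by (intro has_bochner_integral_sum has_bochner_integral_mult_right 1)
  also have "(\<lambda>\<omega>. \<Sum>i\<in>UNIV. \<Sum>j\<in>UNIV. cnj (B $ i $ j) * (?S \<omega> * X \<omega> $ i * cnj (Y \<omega> $ j)))
     = (\<lambda>\<omega>. ?S \<omega> * cnj (?U \<omega>))"
    unfolding herm_prod_matrix_expand[of _ B "Y _"] cnj_sum sum_distrib_left
    by (rule ext, (rule sum.cong[OF refl])+) (simp add: mult_ac)
  finally have SU: "has_bochner_integral M (\<lambda>\<omega>. ?S \<omega> * cnj (?U \<omega>)) 0" by simp
  have "has_bochner_integral M (\<lambda>\<omega>. complex_of_real (c\<^sup>2) * (?S \<omega> * cnj (?S \<omega>))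
       + complex_of_real c * (?S \<omega> * cnj (?U \<omega>)) + complex_of_real c * cnj (?S \<omega> * cnj (?U \<omega>)) + ?U \<omega> * cnj (?U \<omega>))
     (complex_of_real (c\<^sup>2) * (complex_of_real ((cmod (trace (B ** R)))\<^sup>2) + trace (B ** R ** hermitian_transpose B ** R))
       + complex_of_real c * 0 + complex_of_real c * cnj 0 + trace (B ** C ** hermitian_transpose B ** R))"
    by (intro has_bochner_integral_add has_bochner_integral_mult_right has_bochner_integral_cnj SS UU SU)
  also have "(\<lambda>\<omega>. complex_of_real (c\<^sup>2) * (?S \<omega> * cnj (?S \<omega>))
       + complex_of_real c * (?S \<omega> * cnj (?U \<omega>)) + complex_of_real c * cnj (?S \<omega> * cnj (?U \<omega>)) + ?U \<omega> * cnj (?U \<omega>)) =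
     (\<lambda>\<omega>. complex_of_real ((cmod (herm_prod (X \<omega>) (B *v (c *\<^sub>R X \<omega> + Y \<omega>))))\<^sup>2))"
  proof
    fix \<omega>
    have "herm_prod (X \<omega>) (B *v (c *\<^sub>R X \<omega> + Y \<omega>)) = complex_of_real c * ?S \<omega> + ?U \<omega>"
      by (simp only: matrix_vector_right_distrib matrix_vector_mult_scaleR_right
          herm_prod_add_right herm_prod_scaleR_right)
    then show "complex_of_real (c\<^sup>2) * (?S \<omega> * cnj (?S \<omega>))
       + complex_of_real c * (?S \<omega> * cnj (?U \<omega>)) + complex_of_real c * cnj (?S \<omega> * cnj (?U \<omega>)) + ?U \<omega> * cnj (?U \<omega>) =
      complex_of_real ((cmod (herm_prod (X \<omega>) (B *v (c *\<^sub>R X \<omega> + Y \<omega>))))\<^sup>2)"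
      by (simp only: cmod_square_real_combination)
  qed
  finally show ?thesis
    by (simp only: matrix_add_ldistrib matrix_add_rdistrib matrix_mult_scaleR_right
        matrix_mult_scaleR_left trace_add trace_scaleR distrib_left of_real_mult mult_zero_right
        complex_cnj_zero add_0_right add_0_left add.assoc)
qed

subsection \<open>Regularised positive semidefinite matrices\<close>

lemma hermitian_transpose_mult:
  "hermitian_transpose (A ** B) = hermitian_transpose B ** hermitian_transpose (A :: complex^'n^'m)"
  by (simp add: hermitian_transpose_def matrix_matrix_mult_def vec_eq_iff mult.commute)

lemma hermitian_transpose_mat_1: "hermitian_transpose (mat 1) = mat 1"
  by (auto simp: hermitian_transpose_def mat_def vec_eq_iff)

lemma hermitian_transpose_add:
  "hermitian_transpose (A + B) = hermitian_transpose A + hermitian_transpose B"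
  by (simp add: hermitian_transpose_def vec_eq_iff)

lemma hermitian_transpose_scaleR:
  "hermitian_transpose (c *\<^sub>R A) = c *\<^sub>R hermitian_transpose A"
  by (simp add: hermitian_transpose_def vec_eq_iff)

lemma trace_hermitian_transpose: "trace (hermitian_transpose A) = cnj (trace A)"
  by (simp add: trace_def hermitian_transpose_def)

lemma cnj_herm_prod: "cnj (herm_prod x y) = herm_prod y x"
  by (simp add: herm_prod_def mult.commute)

lemma herm_prod_self: "herm_prod x x = complex_of_real ((norm x)\<^sup>2)"
  by (simp add: herm_prod_def norm_vec_def L2_set_def sum_nonneg complex_norm_square mult.commute
      del: of_real_power)

lemma psd_zero: "positive_semidefinite 0"
  by (simp add: positive_semidefinite_def hermitian_transpose_def vec_eq_iff herm_prod_def)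

lemma psd_add:
  assumes "positive_semidefinite A" "positive_semidefinite B"
  shows "positive_semidefinite (A + B)"
  using assms by (simp add: positive_semidefinite_def hermitian_transpose_add
      matrix_vector_mult_add_rdistrib herm_prod_add_right)

lemma matrix_scaleR_vector_mult:
  fixes A :: "complex^'n^'m"
  shows "(c *\<^sub>R A) *v x = c *\<^sub>R (A *v x)"
  by (simp add: vec_eq_iff matrix_vector_mult_def scaleR_sum_right)

lemma psd_scaleR:
  assumes "positive_semidefinite A" "0 \<le> c"
  shows "positive_semidefinite (c *\<^sub>R A)"
  using assms by (simp add: positive_semidefinite_def hermitian_transpose_scaleR
      matrix_scaleR_vector_mult herm_prod_scaleR_right)

lemma psd_sum:
  "(\<And>i. i \<in> I \<Longrightarrow> positive_semidefinite (A i)) \<Longrightarrow> positive_semidefinite (\<Sum>i\<in>I. A i)"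
  by (induction I rule: infinite_finite_induct) (simp_all add: psd_zero psd_add)

lemma
  fixes A :: "complex^'n^'n"
  assumes "invertible A"
  shows matrix_inv_right: "A ** matrix_inv A = mat 1"
    and matrix_inv_left: "matrix_inv A ** A = mat 1"
proof -
  have "\<exists>A'. A ** A' = mat 1 \<and> A' ** A = mat 1" using assms by (simp add: invertible_def)
  then have "A ** matrix_inv A = mat 1 \<and> matrix_inv A ** A = mat 1"
    unfolding matrix_inv_def by (rule someI_ex)
  then show "A ** matrix_inv A = mat 1" "matrix_inv A ** A = mat 1" by auto
qed

context
  fixes S \<Psi> :: "complex^'n^'n" and s :: real
  assumes S: "positive_semidefinite S" and s: "0 < s" and \<Psi>: "\<Psi> = S + s *\<^sub>R mat 1"
begin

lemma regularized_hermitian: "hermitian_transpose \<Psi> = \<Psi>"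
  using S by (simp add: \<Psi> positive_semidefinite_def hermitian_transpose_add
      hermitian_transpose_scaleR hermitian_transpose_mat_1)

lemma regularized_coercive: "s * (norm x)\<^sup>2 \<le> Re (herm_prod x (\<Psi> *v x))"
  using S by (simp add: \<Psi> positive_semidefinite_def matrix_vector_mult_add_rdistrib
      matrix_scaleR_vector_mult herm_prod_add_right herm_prod_scaleR_right herm_prod_self
      del: of_real_power)

lemma regularized_invertible: "invertible \<Psi>"
proof -
  have "x = 0" if "\<Psi> *v x = 0" for x
  proof -
    have "s * (norm x)\<^sup>2 \<le> 0"
      using regularized_coercive[of x] that by (simp add: herm_prod_def)
    then show "x = 0" using s by (simp add: mult_le_0_iff)
  qed
  then have "\<exists>B. B ** \<Psi> = mat 1" by (simp add: matrix_left_invertible_ker)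
  then show ?thesis
    by (auto simp: invertible_def matrix_left_right_inverse)
qed

lemma hermitian_transpose_regularized_inv: "hermitian_transpose (matrix_inv \<Psi>) = matrix_inv \<Psi>"
proof -
  have "hermitian_transpose (matrix_inv \<Psi>) ** \<Psi> = hermitian_transpose (\<Psi> ** matrix_inv \<Psi>)"
    by (simp add: hermitian_transpose_mult regularized_hermitian)
  then have "hermitian_transpose (matrix_inv \<Psi>) ** \<Psi> = mat 1"
    by (simp add: matrix_inv_right[OF regularized_invertible] hermitian_transpose_mat_1)
  then have "hermitian_transpose (matrix_inv \<Psi>) ** (\<Psi> ** matrix_inv \<Psi>) = matrix_inv \<Psi>"
    by (simp add: matrix_mul_assoc)
  then show ?thesis by (simp add: matrix_inv_right[OF regularized_invertible])
qed

lemma regularized_inv_positive: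
  assumes "u \<noteq> 0"
  shows "0 < Re (herm_prod u (matrix_inv \<Psi> *v u))"
proof -
  let ?v = "matrix_inv \<Psi> *v u"
  have u: "\<Psi> *v ?v = u"
    by (simp add: matrix_vector_mul_assoc matrix_inv_right[OF regularized_invertible])
  then have "?v \<noteq> 0" using assms by (metis matrix_vector_mult_0_right)
  then have "0 < s * (norm ?v)\<^sup>2" using s by simp
  also have "\<dots> \<le> Re (herm_prod ?v (\<Psi> *v ?v))" by (rule regularized_coercive)
  also have "\<dots> = Re (herm_prod ?v u)" by (simp only: u)
  also have "\<dots> = Re (herm_prod u ?v)" by (subst cnj_herm_prod[symmetric]) simp
  finally show ?thesis .
qed

lemma trace_regularized_inv_positive:
  fixes R :: "complex^'n^'n"
  assumes R: "hermitian_transpose R = R" and "R \<noteq> 0"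
  shows "0 < Re (trace (R ** matrix_inv \<Psi> ** R))"
proof -
  let ?u = "\<lambda>i. column i R"
  have entry: "(hermitian_transpose R ** (matrix_inv \<Psi> ** R)) $ i $ i = herm_prod (?u i) (matrix_inv \<Psi> *v ?u i)" for i
    by (simp add: matrix_matrix_mult_def hermitian_transpose_def herm_prod_def matrix_vector_mult_def column_def)
  have tr: "Re (trace (R ** matrix_inv \<Psi> ** R)) = (\<Sum>i\<in>UNIV. Re (herm_prod (?u i) (matrix_inv \<Psi> *v ?u i)))"
    using entry unfolding R by (simp add: trace_def matrix_mul_assoc)
  obtain i j where "R $ i $ j \<noteq> 0" using \<open>R \<noteq> 0\<close> by (auto simp: vec_eq_iff)
  then have ne: "?u j \<noteq> 0" by (auto simp: column_def vec_eq_iff)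
  have "0 \<le> Re (herm_prod (?u i) (matrix_inv \<Psi> *v ?u i))" for i
    using regularized_inv_positive[of "?u i"] by (cases "?u i = 0") (auto simp: herm_prod_def)
  then show ?thesis
    unfolding tr by (intro sum_pos2[of _ j] regularized_inv_positive[OF ne]) auto
qed

end

context prob_space
begin

lemma complex_normal_mixture_form:
  fixes X :: "'i \<Rightarrow> 'a \<Rightarrow> complex^'n"
  assumes I: "finite I" "a \<in> I" and indep: "indep_vars (\<lambda>_. borel) X I"
    and X: "\<And>i. i \<in> I \<Longrightarrow> complex_normal_rv M (X i) (C i)"
    and psd: "positive_semidefinite (C a)"
  shows "has_bochner_integral M
     (\<lambda>\<omega>. complex_of_real ((cmod (herm_prod (X a \<omega>) (B *v (\<Sum>i\<in>I. c i *\<^sub>R X i \<omega>))))\<^sup>2))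
     (complex_of_real ((c a)\<^sup>2 * (cmod (trace (B ** C a)))\<^sup>2)
        + trace (B ** (\<Sum>i\<in>I. (c i)\<^sup>2 *\<^sub>R C i) ** hermitian_transpose B ** C a))"
proof -
  have "indep_vars (\<lambda>_. borel) X (I - {a})"
    using indep by (rule indep_vars_subset) auto
  then have Y: "second_order M (\<lambda>\<omega>. \<Sum>i\<in>I - {a}. c i *\<^sub>R X i \<omega>) (\<Sum>i\<in>I - {a}. (c i)\<^sup>2 *\<^sub>R C i)"
    using I X by (intro second_order_weighted_sum complex_normal_rv_second_order) auto
  have ind: "indep_var borel (X a) borel (\<lambda>\<omega>. \<Sum>i\<in>I - {a}. c i *\<^sub>R X i \<omega>)"
    using I indep by (intro indep_var_weighted_sum) (auto simp: insert_absorb)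
  show ?thesis
    using complex_normal_rv_contaminated_form[OF X[OF I(2)] psd Y ind, of B "c a"]
    by (simp only: sum.remove[OF I])
qed

lemma integrable_of_square_norm:
  fixes f :: "'a \<Rightarrow> complex"
  assumes "f \<in> borel_measurable M" "integrable M (\<lambda>x. (cmod (f x))\<^sup>2)"
  shows "integrable M f"
proof (rule Bochner_Integration.integrable_bound)
  show "integrable M (\<lambda>x. 1 + (cmod (f x))\<^sup>2)" using assms(2) by simp
  have "cmod (f x) \<le> 1 + (cmod (f x))\<^sup>2" for x
    using sum_squares_bound[of "cmod (f x)" 1] by (simp add: power2_eq_square) (smt (verit) norm_ge_zero)
  then show "AE x in M. norm (f x) \<le> norm (1 + (cmod (f x))\<^sup>2)"
    by (auto intro: order_trans)
qed fact

end

lemma has_bochner_integral_of_realD: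
  assumes "has_bochner_integral M (\<lambda>x. complex_of_real (f x)) v"
  shows "integrable M f" "complex_of_real (integral\<^sup>L M f) = v"
proof -
  show "integrable M f"
    using integrable_Re[OF integrable.intros[OF assms]] by simp
  show "complex_of_real (integral\<^sup>L M f) = v"
    using assms by (simp add: has_bochner_integral_iff)
qed

subsection \<open>Gains under maximum ratio precoding\<close>

context prob_space
begin

context
  fixes I :: "'i set" and X :: "'i \<Rightarrow> 'a \<Rightarrow> complex^'n" and C :: "'i \<Rightarrow> complex^'n^'n"
    and c :: "'i \<Rightarrow> real" and own a :: 'i and S \<Psi> R :: "complex^'n^'n" and \<tau> s p \<rho> :: real
    and ghat w :: "'a \<Rightarrow> complex^'n" and \<alpha> :: "'a \<Rightarrow> complex"
  assumes I: "finite I" "a \<in> I" and indep: "indep_vars (\<lambda>_. borel) X I"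
    and X: "\<And>i. i \<in> I \<Longrightarrow> complex_normal_rv M (X i) (C i)"
    and R: "positive_semidefinite R" "R \<noteq> 0" and Ca: "positive_semidefinite (C a)"
    and S: "positive_semidefinite S" and pos: "0 < s" "0 < \<tau>" "0 < p" "0 < \<rho>"
    and \<Psi>: "\<Psi> = S + s *\<^sub>R mat 1" and cov: "(\<Sum>i\<in>I. (c i)\<^sup>2 *\<^sub>R C i) = \<tau> *\<^sub>R \<Psi>"
    and ghat: "\<And>\<omega>. \<omega> \<in> space M \<Longrightarrow>
        ghat \<omega> = sqrt p *\<^sub>R ((R ** matrix_inv \<Psi>) *v (\<Sum>i\<in>I. c i *\<^sub>R X i \<omega>))"
    and w: "\<And>\<omega>. \<omega> \<in> space M \<Longrightarrow> w \<omega> = (1 / sqrt (LINT \<omega>'|M. (norm (ghat \<omega>'))\<^sup>2)) *\<^sub>R ghat \<omega>"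
    and \<alpha>: "\<And>\<omega>. \<omega> \<in> space M \<Longrightarrow> \<alpha> \<omega> = complex_of_real (sqrt \<rho>) * herm_prod (X a \<omega>) (w \<omega>)"
begin

lemma estimate_covariance:
  "(R ** matrix_inv \<Psi>) ** (\<tau> *\<^sub>R \<Psi>) ** hermitian_transpose (R ** matrix_inv \<Psi>)
    = \<tau> *\<^sub>R (R ** matrix_inv \<Psi> ** R)"
proof -
  have "(R ** matrix_inv \<Psi>) ** (\<tau> *\<^sub>R \<Psi>) ** hermitian_transpose (R ** matrix_inv \<Psi>)
      = \<tau> *\<^sub>R (R ** (matrix_inv \<Psi> ** \<Psi>) ** (matrix_inv \<Psi> ** R))"
    using R(1) by (simp add: hermitian_transpose_mult positive_semidefinite_def
        hermitian_transpose_regularized_inv[OF S pos(1) \<Psi>] matrix_mult_scaleR_left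
        matrix_mult_scaleR_right matrix_mul_assoc)
  then show ?thesis
    by (simp add: matrix_inv_left[OF regularized_invertible[OF S pos(1) \<Psi>]] matrix_mul_assoc)
qed

lemma trace_estimate_pos: "0 < Re (trace (R ** matrix_inv \<Psi> ** R))"
  using R by (intro trace_regularized_inv_positive[OF S pos(1) \<Psi>]) (auto simp: positive_semidefinite_def)

lemma estimate_power:
  "integrable M (\<lambda>\<omega>. (norm (ghat \<omega>))\<^sup>2)"
  "complex_of_real (LINT \<omega>|M. (norm (ghat \<omega>))\<^sup>2) = complex_of_real (p * \<tau>) * trace (R ** matrix_inv \<Psi> ** R)"
proof -
  have "second_order M (\<lambda>\<omega>. \<Sum>i\<in>I. c i *\<^sub>R X i \<omega>) (\<tau> *\<^sub>R \<Psi>)"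
    unfolding cov[symmetric]
    using I indep X by (intro second_order_weighted_sum complex_normal_rv_second_order)
  from second_order_norm[OF second_order_scaleR[OF second_order_matrix_mult[OF this], of "sqrt p"], of "R ** matrix_inv \<Psi>"]
  have "has_bochner_integral M (\<lambda>\<omega>. complex_of_real ((norm (sqrt p *\<^sub>R ((R ** matrix_inv \<Psi>) *v (\<Sum>i\<in>I. c i *\<^sub>R X i \<omega>))))\<^sup>2))
     (complex_of_real (p * \<tau>) * trace (R ** matrix_inv \<Psi> ** R))"
    unfolding estimate_covariance using pos by (simp only: trace_scaleR real_sqrt_pow2 less_imp_le of_real_mult mult.assoc)
  then have "has_bochner_integral M (\<lambda>\<omega>. complex_of_real ((norm (ghat \<omega>))\<^sup>2))
     (complex_of_real (p * \<tau>) * trace (R ** matrix_inv \<Psi> ** R))"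
    by (subst has_bochner_integral_cong[OF refl _ refl]) (simp_all only: ghat)
  from has_bochner_integral_of_realD[OF this]
  show "integrable M (\<lambda>\<omega>. (norm (ghat \<omega>))\<^sup>2)"
    "complex_of_real (LINT \<omega>|M. (norm (ghat \<omega>))\<^sup>2) = complex_of_real (p * \<tau>) * trace (R ** matrix_inv \<Psi> ** R)" .
qed

lemma estimate_power_pos: "0 < (LINT \<omega>|M. (norm (ghat \<omega>))\<^sup>2)"
proof -
  have "(LINT \<omega>|M. (norm (ghat \<omega>))\<^sup>2) = p * \<tau> * Re (trace (R ** matrix_inv \<Psi> ** R))"
    using arg_cong[OF estimate_power(2), of Re] by simp
  then show ?thesis using trace_estimate_pos pos by simp
qed

lemma effective_gain_power:
  shows "integrable M (\<lambda>\<omega>. (cmod (\<alpha> \<omega>))\<^sup>2)" "integrable M \<alpha>"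
    "complex_of_real (LINT \<omega>|M. (cmod (\<alpha> \<omega>))\<^sup>2) = complex_of_real \<rho> *
       (trace (R ** matrix_inv \<Psi> ** R ** C a) / trace (R ** matrix_inv \<Psi> ** R)
        + complex_of_real ((c a)\<^sup>2 / \<tau> * (cmod (trace (C a ** matrix_inv \<Psi> ** R)))\<^sup>2)
            / trace (R ** matrix_inv \<Psi> ** R))"
proof -
  let ?B = "R ** matrix_inv \<Psi>" and ?G = "LINT \<omega>|M. (norm (ghat \<omega>))\<^sup>2"
  let ?o = "\<lambda>\<omega>. \<Sum>i\<in>I. c i *\<^sub>R X i \<omega>"
  let ?t = "trace (R ** matrix_inv \<Psi> ** R)"
  have \<alpha>_eq: "\<alpha> \<omega> = complex_of_real (sqrt \<rho> * sqrt p / sqrt ?G) * herm_prod (X a \<omega>) (?B *v ?o \<omega>)"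
    if "\<omega> \<in> space M" for \<omega>
    using that by (simp add: \<alpha> w ghat herm_prod_scaleR_right)
  have sq: "(sqrt \<rho> * sqrt p / sqrt ?G)\<^sup>2 = \<rho> * p / ?G"
    using pos estimate_power_pos by (simp add: power_mult_distrib power_divide)
  have "hermitian_transpose (?B ** C a) = C a ** matrix_inv \<Psi> ** R"
    using R(1) Ca by (simp add: hermitian_transpose_mult positive_semidefinite_def
        hermitian_transpose_regularized_inv[OF S pos(1) \<Psi>] matrix_mul_assoc)
  then have cm: "cmod (trace (?B ** C a)) = cmod (trace (C a ** matrix_inv \<Psi> ** R))"
    by (metis trace_hermitian_transpose complex_mod_cnj)
  have "has_bochner_integral M
     (\<lambda>\<omega>. complex_of_real ((cmod (herm_prod (X a \<omega>) (?B *v ?o \<omega>)))\<^sup>2))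
     (complex_of_real ((c a)\<^sup>2 * (cmod (trace (?B ** C a)))\<^sup>2)
        + trace (?B ** (\<Sum>i\<in>I. (c i)\<^sup>2 *\<^sub>R C i) ** hermitian_transpose ?B ** C a))"
    by (rule complex_normal_mixture_form[OF I indep X Ca])
  then have "has_bochner_integral M
     (\<lambda>\<omega>. complex_of_real ((cmod (herm_prod (X a \<omega>) (?B *v ?o \<omega>)))\<^sup>2))
     (complex_of_real ((c a)\<^sup>2 * (cmod (trace (C a ** matrix_inv \<Psi> ** R)))\<^sup>2)
        + complex_of_real \<tau> * trace (R ** matrix_inv \<Psi> ** R ** C a))"
    unfolding cov estimate_covariance cm by (simp only: matrix_mult_scaleR_left trace_scaleR)
  note has_bochner_integral_mult_right[OF this, of "complex_of_real (\<rho> * p / ?G)"]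
  then have "has_bochner_integral M (\<lambda>\<omega>. complex_of_real ((cmod (\<alpha> \<omega>))\<^sup>2))
     (complex_of_real (\<rho> * p / ?G) * (complex_of_real ((c a)\<^sup>2 * (cmod (trace (C a ** matrix_inv \<Psi> ** R)))\<^sup>2)
        + complex_of_real \<tau> * trace (R ** matrix_inv \<Psi> ** R ** C a)))"
    by (subst has_bochner_integral_cong[OF refl _ refl])
      (simp_all only: \<alpha>_eq norm_mult power_mult_distrib norm_of_real power2_abs sq of_real_mult)
  note * = has_bochner_integral_of_realD[OF this]
  show 1: "integrable M (\<lambda>\<omega>. (cmod (\<alpha> \<omega>))\<^sup>2)" by (rule *)
  have [measurable]: "X i \<in> borel_measurable M" if "i \<in> I" for i
    using X[OF that] by (simp add: complex_normal_rv_def)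
  have "(\<lambda>\<omega>. complex_of_real (sqrt \<rho> * sqrt p / sqrt ?G) * herm_prod (X a \<omega>) (?B *v ?o \<omega>)) \<in> borel_measurable M"
    using I by measurable
  then have "\<alpha> \<in> borel_measurable M"
    by (subst measurable_cong[OF \<alpha>_eq])
  then show "integrable M \<alpha>" using 1 by (rule integrable_of_square_norm)
  have ne: "?t \<noteq> 0" using trace_estimate_pos by auto
  have "complex_of_real (\<rho> * p / ?G) = complex_of_real \<rho> / (complex_of_real \<tau> * ?t)"
    using pos ne by (simp add: estimate_power(2))
  with *(2) have "complex_of_real (LINT \<omega>|M. (cmod (\<alpha> \<omega>))\<^sup>2) = complex_of_real \<rho> / (complex_of_real \<tau> * ?t) *
     (complex_of_real ((c a)\<^sup>2 * (cmod (trace (C a ** matrix_inv \<Psi> ** R)))\<^sup>2)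
        + complex_of_real \<tau> * trace (R ** matrix_inv \<Psi> ** R ** C a))"
    by (simp only:)
  also have "\<dots> = complex_of_real \<rho> *
       (trace (R ** matrix_inv \<Psi> ** R ** C a) / ?t
        + complex_of_real ((c a)\<^sup>2 / \<tau> * (cmod (trace (C a ** matrix_inv \<Psi> ** R)))\<^sup>2) / ?t)"
    using pos ne by (simp add: field_simps)
  finally show "complex_of_real (LINT \<omega>|M. (cmod (\<alpha> \<omega>))\<^sup>2) = complex_of_real \<rho> *
       (trace (R ** matrix_inv \<Psi> ** R ** C a) / ?t
        + complex_of_real ((c a)\<^sup>2 / \<tau> * (cmod (trace (C a ** matrix_inv \<Psi> ** R)))\<^sup>2) / ?t)" .
qed

end

end

lemma sum_single_pilot:
  fixes f :: "'b \<Rightarrow> 'c::comm_monoid_add"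
  assumes "finite A" "finite U" "P \<subseteq> A" "b \<in> A" "u \<in> U"
  shows "(\<Sum>i\<in>(A \<times> A \<times> U) <+> (A \<times> U). case i of
      Inl (b', j, u') \<Rightarrow> if b' = b \<and> u' = u \<and> j \<in> P then f j else 0
    | Inr (b', u') \<Rightarrow> if b' = b \<and> u' = u then h else 0) = (\<Sum>j\<in>P. f j) + h"
proof -
  let ?F = "\<lambda>(b', j, u'). if b' = b \<and> u' = u \<and> j \<in> P then f j else 0"
  have "sum ?F (A \<times> A \<times> U) = sum ?F ((\<lambda>j. (b, j, u)) ` P)"
    using assms by (intro sum.mono_neutral_right) auto
  also have "\<dots> = (\<Sum>j\<in>P. f j)"
    by (subst sum.reindex) (auto simp: inj_on_def)
  finally have 1: "sum ?F (A \<times> A \<times> U) = (\<Sum>j\<in>P. f j)" .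
  have "(\<Sum>(b', u')\<in>A \<times> U. if b' = b \<and> u' = u then h else 0)
      = (\<Sum>(b', u')\<in>{(b, u)}. if b' = b \<and> u' = u then h else 0)"
    using assms by (intro sum.mono_neutral_right) (auto split: if_splits)
  then show ?thesis
    using assms 1 by (simp add: sum.Plus comp_def)
qed

theorem lemma4:
  fixes \<Omega> :: "'w measure"
    and L K \<tau>p \<tau>c :: nat
    and \<G> :: "nat set set"
    and P :: "nat \<Rightarrow> nat set"
    and R :: "nat \<Rightarrow> nat \<Rightarrow> nat \<Rightarrow> complex^'m^'m"
    and \<Psi> :: "nat \<Rightarrow> nat \<Rightarrow> complex^'m^'m"
    and g :: "nat \<Rightarrow> nat \<Rightarrow> nat \<Rightarrow> 'w \<Rightarrow> complex^'m"
    and noise obs ghat w :: "nat \<Rightarrow> nat \<Rightarrow> 'w \<Rightarrow> complex^'m"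
    and \<alpha> :: "nat \<Rightarrow> nat \<Rightarrow> nat \<Rightarrow> nat \<Rightarrow> 'w \<Rightarrow> complex"
    and y :: "nat \<Rightarrow> nat \<Rightarrow> nat \<Rightarrow> 'w \<Rightarrow> complex"
    and \<alpha>hat :: "nat \<Rightarrow> nat \<Rightarrow> 'w \<Rightarrow> complex"
    and \<xi> :: "nat \<Rightarrow> nat \<Rightarrow> 'w \<Rightarrow> real"
    and phat \<eta> T thr :: "nat \<Rightarrow> nat \<Rightarrow> real"
    and \<rho> \<sigma>UL \<sigma>DL :: real
    and l k :: nat
  assumes "prob_space \<Omega>"
    and "0 < \<tau>p" and "\<tau>p < \<tau>c"
    and "0 < \<rho>" and "0 < \<sigma>UL" and "0 \<le> \<sigma>DL"
    and "\<forall>l\<in>{1..L}. \<forall>k\<in>{1..K}. 0 < phat l k"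
    and "\<forall>l\<in>{1..L}. \<forall>k\<in>{1..K}. 0 \<le> \<eta> l k \<and> \<eta> l k \<le> 1"
    \<comment> \<open>pilot groups: \<open>P l\<close> is the group containing cell \<open>l\<close>\<close>
    and "partition_on {1..L} \<G>"
    and "\<forall>l\<in>{1..L}. P l \<in> \<G> \<and> l \<in> P l"
    \<comment> \<open>\<open>g l l' k'\<close> is the channel between BS \<open>l\<close> and user \<open>k'\<close> of cell \<open>l'\<close>, and \<open>R l l' k'\<close> its covariance\<close>
    and "\<forall>l\<in>{1..L}. \<forall>l'\<in>{1..L}. \<forall>k'\<in>{1..K}. positive_semidefinite (R l l' k')"
    and "\<forall>l\<in>{1..L}. \<forall>k\<in>{1..K}. R l l k \<noteq> 0"
    and "\<forall>l\<in>{1..L}. \<forall>l'\<in>{1..L}. \<forall>k'\<in>{1..K}. complex_normal_rv \<Omega> (g l l' k') (R l l' k')"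
    and "\<forall>l\<in>{1..L}. \<forall>k\<in>{1..K}.
           complex_normal_rv \<Omega> (noise l k) ((real \<tau>p * \<sigma>UL\<^sup>2) *\<^sub>R mat 1)"
    and "prob_space.indep_vars \<Omega> (\<lambda>_. borel)
           (case_sum (\<lambda>(l, l', k'). g l l' k') (\<lambda>(l, k). noise l k))
           (({1..L} \<times> {1..L} \<times> {1..K}) <+> ({1..L} \<times> {1..K}))"
    \<comment> \<open>pilot observations and MMSE channel estimates\<close>
    and "\<forall>l\<in>{1..L}. \<forall>k\<in>{1..K}. \<forall>\<omega>\<in>space \<Omega>.
           obs l k \<omega> = (\<Sum>l'\<in>P l. (real \<tau>p * sqrt (phat l' k)) *\<^sub>R g l l' k \<omega>) + noise l k \<omega>"
    and "\<forall>l\<in>{1..L}. \<forall>k\<in>{1..K}.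
           \<Psi> l k = (\<Sum>l'\<in>P l. (real \<tau>p * phat l' k) *\<^sub>R R l l' k) + \<sigma>UL\<^sup>2 *\<^sub>R mat 1"
    and "\<forall>l\<in>{1..L}. \<forall>k\<in>{1..K}. \<forall>\<omega>\<in>space \<Omega>.
           ghat l k \<omega> = sqrt (phat l k) *\<^sub>R ((R l l k ** matrix_inv (\<Psi> l k)) *v obs l k \<omega>)"
    \<comment> \<open>MR precoding and effective channel gains\<close>
    and "\<forall>l\<in>{1..L}. \<forall>k\<in>{1..K}. \<forall>\<omega>\<in>space \<Omega>.
           w l k \<omega> = (1 / sqrt (LINT \<omega>'|\<Omega>. (norm (ghat l k \<omega>'))\<^sup>2)) *\<^sub>R ghat l k \<omega>"
    and "\<forall>l\<in>{1..L}. \<forall>k\<in>{1..K}. \<forall>l'\<in>{1..L}. \<forall>k'\<in>{1..K}. \<forall>\<omega>\<in>space \<Omega>.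
           \<alpha> l k l' k' \<omega> = complex_of_real (sqrt \<rho>) * herm_prod (g l' l k \<omega>) (w l' k' \<omega>)"
    \<comment> \<open>sample average power of the received signals, and the estimator\<close>
    and "\<forall>l\<in>{1..L}. \<forall>k\<in>{1..K}. \<forall>\<omega>\<in>space \<Omega>.
           \<xi> l k \<omega> = 1 / (real \<tau>c - real \<tau>p) * (\<Sum>n\<in>{\<tau>p+1..\<tau>c}. (cmod (y l k n \<omega>))\<^sup>2)"
    and "\<forall>l\<in>{1..L}. \<forall>k\<in>{1..K}.
           T l k = (\<Sum>k'\<in>{1..K} - {k}. \<eta> l k' * (LINT \<omega>|\<Omega>. (cmod (\<alpha> l k l k' \<omega>))\<^sup>2))
                 + (\<Sum>l'\<in>{1..L} - {l}. \<Sum>k'\<in>{1..K}.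
                      \<eta> l' k' * (LINT \<omega>|\<Omega>. (cmod (\<alpha> l k l' k' \<omega>))\<^sup>2))
                 + \<sigma>DL\<^sup>2"
    and "\<forall>l\<in>{1..L}. \<forall>k\<in>{1..K}. T l k \<le> thr l k"
    and "\<forall>l\<in>{1..L}. \<forall>k\<in>{1..K}. \<forall>\<omega>\<in>space \<Omega>.
           \<alpha>hat l k \<omega> = (if \<xi> l k \<omega> > thr l k
                         then complex_of_real (sqrt ((\<xi> l k \<omega> - T l k) / \<eta> l k))
                         else (LINT \<omega>'|\<Omega>. \<alpha> l k l k \<omega>'))"
    and "l \<in> {1..L}" and "k \<in> {1..K}"
  shows
    \<comment> \<open>the inverses, denominators and expectations involved are well defined\<close>
    "(\<forall>l'\<in>{1..L}. \<forall>k'\<in>{1..K}.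
        invertible (\<Psi> l' k') \<and>
        trace (R l' l' k' ** matrix_inv (\<Psi> l' k') ** R l' l' k') \<noteq> 0 \<and>
        integrable \<Omega> (\<lambda>\<omega>. (norm (ghat l' k' \<omega>))\<^sup>2) \<and>
        (LINT \<omega>|\<Omega>. (norm (ghat l' k' \<omega>))\<^sup>2) > 0 \<and>
        integrable \<Omega> (\<lambda>\<omega>. (cmod (\<alpha> l k l' k' \<omega>))\<^sup>2)) \<and>
     integrable \<Omega> (\<alpha> l k l k) \<and>
     (let Tcf :: complex =
            (\<Sum>k'\<in>{1..K} - {k}. complex_of_real (\<rho> * \<eta> l k')
               * trace (R l l k' ** matrix_inv (\<Psi> l k') ** R l l k' ** R l l k)
               / trace (R l l k' ** matrix_inv (\<Psi> l k') ** R l l k'))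
          + (\<Sum>l'\<in>{1..L} - {l}. \<Sum>k'\<in>{1..K}. complex_of_real (\<rho> * \<eta> l' k')
               * trace (R l' l' k' ** matrix_inv (\<Psi> l' k') ** R l' l' k' ** R l' l k)
               / trace (R l' l' k' ** matrix_inv (\<Psi> l' k') ** R l' l' k'))
          + (\<Sum>l'\<in>P l - {l}. complex_of_real (\<rho> * \<eta> l' k)
               * complex_of_real (phat l k * real \<tau>p
                   * (cmod (trace (R l' l k ** matrix_inv (\<Psi> l' k) ** R l' l' k)))\<^sup>2)
               / trace (R l' l' k ** matrix_inv (\<Psi> l' k) ** R l' l' k))
          + complex_of_real (\<sigma>DL\<^sup>2)
      in complex_of_real (T l k) = Tcf \<and>
         (\<forall>\<omega>\<in>space \<Omega>.
            \<alpha>hat l k \<omega> = (if \<xi> l k \<omega> > thr l k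
                          then complex_of_real (sqrt ((\<xi> l k \<omega> - Re Tcf) / \<eta> l k))
                          else (LINT \<omega>'|\<Omega>. \<alpha> l k l k \<omega>'))))"
proof -
  interpret prob_space \<Omega> by (rule assms(1))
  let ?I = "({1..L} \<times> {1..L} \<times> {1..K}) <+> ({1..L} \<times> {1..K})"
  let ?X = "case_sum (\<lambda>(l, l', k'). g l l' k') (\<lambda>(l, k). noise l k)"
  define C :: "nat \<times> nat \<times> nat + nat \<times> nat \<Rightarrow> complex^'m^'m" where
    "C = case_sum (\<lambda>(l, l', k'). R l l' k') (\<lambda>_. (real \<tau>p * \<sigma>UL\<^sup>2) *\<^sub>R mat 1)"
  \<comment> \<open>Weights over all channels and noises, zero off the pilot group: both kinds of interferer,
    inside and outside the group, are then indices of the same sum.\<close>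
  define c :: "nat \<Rightarrow> nat \<Rightarrow> nat \<times> nat \<times> nat + nat \<times> nat \<Rightarrow> real" where
    "c = (\<lambda>b u i. case i of
        Inl (b', j, u') \<Rightarrow> if b' = b \<and> u' = u \<and> j \<in> P b then real \<tau>p * sqrt (phat j u) else 0
      | Inr (b', u') \<Rightarrow> if b' = b \<and> u' = u then 1 else 0)"
  define t where "t = (\<lambda>l' k'. trace (R l' l' k' ** matrix_inv (\<Psi> l' k') ** R l' l' k'))"
  define N where "N = (\<lambda>l' k'. trace (R l' l' k' ** matrix_inv (\<Psi> l' k') ** R l' l' k' ** R l' l k))"
  define Q where "Q = (\<lambda>l' k'. (cmod (trace (R l' l k ** matrix_inv (\<Psi> l' k') ** R l' l' k')))\<^sup>2)"
  have P_sub: "P b \<subseteq> {1..L}" if "b \<in> {1..L}" for b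
    using assms(9,10) that by (auto simp: partition_on_def)
  have P_eq: "P b = P b'" if "b \<in> {1..L}" "b' \<in> {1..L}" "b \<in> P b'" for b b'
  proof (rule ccontr)
    assume "P b \<noteq> P b'"
    then have "P b \<inter> P b' = {}"
      using assms(9,10) that(1,2) unfolding partition_on_def disjoint_def by blast
    then show False using assms(10) that by blast
  qed
  have key:
    "invertible (\<Psi> l' k') \<and> t l' k' \<noteq> 0 \<and> integrable \<Omega> (\<lambda>\<omega>. (norm (ghat l' k' \<omega>))\<^sup>2) \<and>
      (LINT \<omega>|\<Omega>. (norm (ghat l' k' \<omega>))\<^sup>2) > 0 \<and> integrable \<Omega> (\<lambda>\<omega>. (cmod (\<alpha> l k l' k' \<omega>))\<^sup>2) \<and>
      integrable \<Omega> (\<alpha> l k l' k') \<and>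
      complex_of_real (LINT \<omega>|\<Omega>. (cmod (\<alpha> l k l' k' \<omega>))\<^sup>2) = complex_of_real \<rho> *
        (N l' k' / t l' k' + complex_of_real ((c l' k' (Inl (l', l, k)))\<^sup>2 / real \<tau>p * Q l' k') / t l' k')"
    if l': "l' \<in> {1..L}" and k': "k' \<in> {1..K}" for l' k'
  proof -
    let ?S = "\<Sum>j\<in>P l'. (real \<tau>p * phat j k') *\<^sub>R R l' j k'"
    have j: "j \<in> {1..L}" "0 < phat j k'" if "j \<in> P l'" for j
      using P_sub[OF l'] that assms(7) k' by auto
    have 1: "finite ?I" "Inl (l', l, k) \<in> ?I" using assms(25,26) l' by auto
    have 2: "indep_vars (\<lambda>_. borel) ?X ?I" by (rule assms(15))
    have 3: "complex_normal_rv \<Omega> (?X i) (C i)" if "i \<in> ?I" for i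
      using that assms(13,14) by (auto simp: C_def)
    have 4: "positive_semidefinite (R l' l' k')" "R l' l' k' \<noteq> 0" "positive_semidefinite (C (Inl (l', l, k)))"
      using assms(11,12,25,26) l' k' by (auto simp: C_def)
    have 5: "positive_semidefinite ?S"
      using assms(11) l' k' j by (intro psd_sum psd_scaleR) (auto intro!: mult_nonneg_nonneg less_imp_le[OF j(2)])
    have 6: "0 < \<sigma>UL\<^sup>2" "0 < real \<tau>p" "0 < phat l' k'" "0 < \<rho>"
      using assms(2,4,5,7) l' k' by auto
    have 7: "\<Psi> l' k' = ?S + \<sigma>UL\<^sup>2 *\<^sub>R mat 1" using assms(17) l' k' by blast
    have "(\<Sum>i\<in>?I. (c l' k' i)\<^sup>2 *\<^sub>R C i) = (\<Sum>i\<in>?I. case i of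
        Inl (b', j, u') \<Rightarrow> if b' = l' \<and> u' = k' \<and> j \<in> P l' then ((real \<tau>p)\<^sup>2 * phat j k') *\<^sub>R R l' j k' else 0
      | Inr (b', u') \<Rightarrow> if b' = l' \<and> u' = k' then (real \<tau>p * \<sigma>UL\<^sup>2) *\<^sub>R mat 1 else 0)"
      using j by (intro sum.cong) (auto simp: c_def C_def power_mult_distrib less_imp_le)
    also have "\<dots> = (\<Sum>j\<in>P l'. ((real \<tau>p)\<^sup>2 * phat j k') *\<^sub>R R l' j k') + (real \<tau>p * \<sigma>UL\<^sup>2) *\<^sub>R mat 1"
      using l' k' P_sub[OF l'] by (intro sum_single_pilot) auto
    also have "\<dots> = real \<tau>p *\<^sub>R \<Psi> l' k'"
      by (simp add: 7 scaleR_add_right scaleR_sum_right power2_eq_square mult.assoc)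
    finally have 8: "(\<Sum>i\<in>?I. (c l' k' i)\<^sup>2 *\<^sub>R C i) = real \<tau>p *\<^sub>R \<Psi> l' k'" .
    have 9: "ghat l' k' \<omega> = sqrt (phat l' k') *\<^sub>R ((R l' l' k' ** matrix_inv (\<Psi> l' k')) *v (\<Sum>i\<in>?I. c l' k' i *\<^sub>R ?X i \<omega>))"
      if "\<omega> \<in> space \<Omega>" for \<omega>
    proof -
      have "(\<Sum>i\<in>?I. c l' k' i *\<^sub>R ?X i \<omega>) = (\<Sum>i\<in>?I. case i of
          Inl (b', j, u') \<Rightarrow> if b' = l' \<and> u' = k' \<and> j \<in> P l' then (real \<tau>p * sqrt (phat j k')) *\<^sub>R g l' j k' \<omega> else 0
        | Inr (b', u') \<Rightarrow> if b' = l' \<and> u' = k' then noise l' k' \<omega> else 0)"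
        by (intro sum.cong) (auto simp: c_def)
      also have "\<dots> = (\<Sum>j\<in>P l'. (real \<tau>p * sqrt (phat j k')) *\<^sub>R g l' j k' \<omega>) + noise l' k' \<omega>"
        using l' k' P_sub[OF l'] by (intro sum_single_pilot) auto
      also have "\<dots> = obs l' k' \<omega>" using assms(16) l' k' that by simp
      finally show ?thesis using assms(18) l' k' that by simp
    qed
    have 10: "w l' k' \<omega> = (1 / sqrt (LINT \<omega>'|\<Omega>. (norm (ghat l' k' \<omega>'))\<^sup>2)) *\<^sub>R ghat l' k' \<omega>"
      if "\<omega> \<in> space \<Omega>" for \<omega>
      using assms(19) l' k' that by blast
    have 11: "\<alpha> l k l' k' \<omega> = complex_of_real (sqrt \<rho>) * herm_prod (?X (Inl (l', l, k)) \<omega>) (w l' k' \<omega>)"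
      if "\<omega> \<in> space \<Omega>" for \<omega>
      using assms(20,25,26) l' k' that by simp
    note prems = 1 2 3 4 5 6 7 8 9 10 11
    have t_pos: "0 < Re (t l' k')"
      unfolding t_def by (rule trace_estimate_pos[OF prems])
    note gain = effective_gain_power[OF prems]
    have "C (Inl (l', l, k)) = R l' l k" by (simp add: C_def)
    with gain(3) have "complex_of_real (LINT \<omega>|\<Omega>. (cmod (\<alpha> l k l' k' \<omega>))\<^sup>2) = complex_of_real \<rho> *
        (N l' k' / t l' k' + complex_of_real ((c l' k' (Inl (l', l, k)))\<^sup>2 / real \<tau>p * Q l' k') / t l' k')"
      unfolding N_def t_def Q_def by (simp only:)
    then show ?thesis
      using regularized_invertible[OF 5 6(1) 7] t_pos estimate_power(1)[OF prems]
        estimate_power_pos[OF prems] gain(1,2) by auto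
  qed
  define D where "D = (\<lambda>l'. complex_of_real (phat l k * real \<tau>p * Q l' k) / t l' k)"
  have gain: "complex_of_real (\<eta> l' k' * (LINT \<omega>|\<Omega>. (cmod (\<alpha> l k l' k' \<omega>))\<^sup>2))
      = complex_of_real (\<rho> * \<eta> l' k') * N l' k' / t l' k'
        + (if k' = k then if l \<in> P l' then complex_of_real (\<rho> * \<eta> l' k) * D l' else 0 else 0)"
    if l': "l' \<in> {1..L}" and k': "k' \<in> {1..K}" for l' k'
  proof -
    have "(c l' k' (Inl (l', l, k)))\<^sup>2 / real \<tau>p = (if k' = k \<and> l \<in> P l' then phat l k * real \<tau>p else 0)"
      using assms(2,7,25,26) by (auto simp: c_def power_mult_distrib power2_eq_square less_imp_le)
    then show ?thesis
      using key[OF l' k'] by (auto simp: D_def algebra_simps)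
  qed
  have P_iff: "l \<in> P l' \<longleftrightarrow> l' \<in> P l" if "l' \<in> {1..L}" for l'
    using P_eq[of l l'] P_eq[of l' l] assms(10,25) that by blast
  have sum1: "(\<Sum>k'\<in>{1..K} - {k}. complex_of_real (\<eta> l k' * (LINT \<omega>|\<Omega>. (cmod (\<alpha> l k l k' \<omega>))\<^sup>2)))
      = (\<Sum>k'\<in>{1..K} - {k}. complex_of_real (\<rho> * \<eta> l k') * N l k' / t l k')"
    using gain[OF assms(25)] by (intro sum.cong) auto
  have "(\<Sum>l'\<in>{1..L} - {l}. \<Sum>k'\<in>{1..K}. complex_of_real (\<eta> l' k' * (LINT \<omega>|\<Omega>. (cmod (\<alpha> l k l' k' \<omega>))\<^sup>2)))
      = (\<Sum>l'\<in>{1..L} - {l}. \<Sum>k'\<in>{1..K}. complex_of_real (\<rho> * \<eta> l' k') * N l' k' / t l' k'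
        + (if k' = k then if l \<in> P l' then complex_of_real (\<rho> * \<eta> l' k) * D l' else 0 else 0))"
    using gain by (intro sum.cong refl) auto
  also have "\<dots> = (\<Sum>l'\<in>{1..L} - {l}. \<Sum>k'\<in>{1..K}. complex_of_real (\<rho> * \<eta> l' k') * N l' k' / t l' k')
      + (\<Sum>l'\<in>{1..L} - {l}. if l \<in> P l' then complex_of_real (\<rho> * \<eta> l' k) * D l' else 0)"
    using assms(26) by (simp add: sum.distrib)
  also have "(\<Sum>l'\<in>{1..L} - {l}. if l \<in> P l' then complex_of_real (\<rho> * \<eta> l' k) * D l' else 0)
      = (\<Sum>l'\<in>P l - {l}. complex_of_real (\<rho> * \<eta> l' k) * D l')"
    using P_sub[OF assms(25)] P_iff by (intro sum.mono_neutral_cong_right) auto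
  finally have sum2: "(\<Sum>l'\<in>{1..L} - {l}. \<Sum>k'\<in>{1..K}. complex_of_real (\<eta> l' k' * (LINT \<omega>|\<Omega>. (cmod (\<alpha> l k l' k' \<omega>))\<^sup>2)))
      = (\<Sum>l'\<in>{1..L} - {l}. \<Sum>k'\<in>{1..K}. complex_of_real (\<rho> * \<eta> l' k') * N l' k' / t l' k')
        + (\<Sum>l'\<in>P l - {l}. complex_of_real (\<rho> * \<eta> l' k) * D l')" .
  have "T l k = (\<Sum>k'\<in>{1..K} - {k}. \<eta> l k' * (LINT \<omega>|\<Omega>. (cmod (\<alpha> l k l k' \<omega>))\<^sup>2))
      + (\<Sum>l'\<in>{1..L} - {l}. \<Sum>k'\<in>{1..K}. \<eta> l' k' * (LINT \<omega>|\<Omega>. (cmod (\<alpha> l k l' k' \<omega>))\<^sup>2))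
      + \<sigma>DL\<^sup>2"
    using assms(22,25,26) by blast
  then have T: "complex_of_real (T l k) =
      (\<Sum>k'\<in>{1..K} - {k}. complex_of_real (\<rho> * \<eta> l k') * N l k' / t l k')
      + (\<Sum>l'\<in>{1..L} - {l}. \<Sum>k'\<in>{1..K}. complex_of_real (\<rho> * \<eta> l' k') * N l' k' / t l' k')
      + (\<Sum>l'\<in>P l - {l}. complex_of_real (\<rho> * \<eta> l' k) * complex_of_real (phat l k * real \<tau>p * Q l' k) / t l' k)
      + complex_of_real (\<sigma>DL\<^sup>2)"
    by (simp only: of_real_add of_real_sum sum1 sum2 D_def add.assoc times_divide_eq_right)
  have \<alpha>hat: "\<forall>\<omega>\<in>space \<Omega>. \<alpha>hat l k \<omega> = (if \<xi> l k \<omega> > thr l k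
      then complex_of_real (sqrt ((\<xi> l k \<omega> - Re (complex_of_real (T l k))) / \<eta> l k))
      else (LINT \<omega>'|\<Omega>. \<alpha> l k l k \<omega>'))"
    using assms(24-26) by simp
  show ?thesis
    unfolding Let_def
  proof (intro conjI)
    show "\<forall>l'\<in>{1..L}. \<forall>k'\<in>{1..K}.
        invertible (\<Psi> l' k') \<and>
        trace (R l' l' k' ** matrix_inv (\<Psi> l' k') ** R l' l' k') \<noteq> 0 \<and>
        integrable \<Omega> (\<lambda>\<omega>. (norm (ghat l' k' \<omega>))\<^sup>2) \<and>
        (LINT \<omega>|\<Omega>. (norm (ghat l' k' \<omega>))\<^sup>2) > 0 \<and>
        integrable \<Omega> (\<lambda>\<omega>. (cmod (\<alpha> l k l' k' \<omega>))\<^sup>2)"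
      using key unfolding t_def by blast
    show "integrable \<Omega> (\<alpha> l k l k)" using key assms(25,26) by blast
  qed (fact T[unfolded N_def t_def Q_def] \<alpha>hat[unfolded T[unfolded N_def t_def Q_def]])+
qed

end
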